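(* For every integer $l\ge 1$, there is exactly one free crystallized polyomino $A$ with $h(A)=(2^{2l}-1)/3$.
   Context: A polyomino is a finite union of closed unit squares (tiles) of the square lattice, any two meeting (if at all) in a whole edge, whose interior is connected. Its holes are the bounded connected components of its complement in the plane; $h(A)$ is the number of holes and $|A|$ the number of tiles. For $h\ge1$, $g(h)=\min\{|A|: h(A)=h\}$, and a polyomino with $h$ holes is crystallized if it has $g(h)$ tiles. Free polyominoes are polyominoes considered up to translations, rotations and reflections. *)

theory Defs
  imports "HOL-Analysis.Analysis"
begin

definition tile :: "int \<times> int \<Rightarrow> (real \<times> real) set" where
  "tile c = cbox (real_of_int (fst c), real_of_int (snd c))
                 (real_of_int (fst c) + 1, real_of_int (snd c) + 1)"

definition region :: "(int \<times> int) set \<Rightarrow> (real \<times> real) set" where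
  "region A = (\<Union>c\<in>A. tile c)"

definition polyomino :: "(int \<times> int) set \<Rightarrow> bool" where
  "polyomino A \<longleftrightarrow> finite A \<and> A \<noteq> {} \<and> connected (interior (region A))"

definition holes :: "(int \<times> int) set \<Rightarrow> nat" where
  "holes A = card {C \<in> components (- region A). bounded C}"

definition g :: "nat \<Rightarrow> nat" where
  "g h = (LEAST n. \<exists>A. polyomino A \<and> holes A = h \<and> card A = n)"

definition crystallized :: "(int \<times> int) set \<Rightarrow> bool" where
  "crystallized A \<longleftrightarrow> polyomino A \<and> holes A \<ge> 1 \<and> card A = g (holes A)"

definition lattice_symmetries :: "(int \<times> int \<Rightarrow> int \<times> int) set" where
  "lattice_symmetries =
     {\<lambda>(x,y). (x,y), \<lambda>(x,y). (-y,x), \<lambda>(x,y). (-x,-y), \<lambda>(x,y). (y,-x),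
      \<lambda>(x,y). (-x,y), \<lambda>(x,y). (x,-y), \<lambda>(x,y). (y,x), \<lambda>(x,y). (-y,-x)}"

definition free_equiv :: "(int \<times> int) set \<Rightarrow> (int \<times> int) set \<Rightarrow> bool" where
  "free_equiv A B \<longleftrightarrow>
     (\<exists>\<sigma>\<in>lattice_symmetries. \<exists>t :: int \<times> int. B = (\<lambda>c. \<sigma> c + t) ` A)"

end

theory Submission
  imports Defs
begin

text \<open>
  Let \<open>n = |A|\<close>, \<open>h = h(A)\<close>, and let \<open>F\<close> be \<open>A\<close> with its holes filled in, meeting \<open>c\<close> columns and
  \<open>r\<close> rows. Counting upper and right boundary edges of \<open>A\<close>, and using that the adjacency graph of
  \<open>A\<close> has at least \<open>n - 1\<close> edges, gives \<open>c + r + 2 h \<le> n + 1\<close>, while \<open>n + h \<le> c r\<close>. For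
  \<open>h = (4^l - 1) / 3\<close> and \<open>m = 2^l + 1\<close> this forces \<open>n \<ge> m^2 - 1 - h\<close>; in the case of equality the
  adjacency graph is a tree, all holes are single cells, and \<open>F\<close> is an \<open>m \<times> m\<close> square without a
  corner or a full \<open>(m - 1) \<times> (m + 1)\<close> rectangle.

  On a tree the discrete form \<open>x dy\<close> has a potential. This excludes \<open>2 \<times> 2\<close> blocks of tiles, and,
  integrated around a set of holes, any nonempty set of holes not linked diagonally to the remaining
  complement. So the full rectangle is impossible, and with the missing corner at the origin every
  hole \<open>(x, y)\<close> has \<open>x + y\<close> even. Every cell with \<open>x + y\<close> odd is then a tile, and since no block is
  full, connectedness of \<open>A\<close> makes every cell with both coordinates odd a hole. The cells with both
  coordinates even form the same problem at half the size, so the pattern is unique by induction on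
  \<open>l\<close>.
\<close>

subsection \<open>Area potentials and the recursive hole pattern\<close>

definition adj :: "int \<times> int \<Rightarrow> int \<times> int \<Rightarrow> bool" where
  "adj a b \<longleftrightarrow> \<bar>fst a - fst b\<bar> + \<bar>snd a - snd b\<bar> = 1"

lemma adj_iff:
  "adj (x, y) b \<longleftrightarrow> b = (x + 1, y) \<or> b = (x - 1, y) \<or> b = (x, y + 1) \<or> b = (x, y - 1)"
  unfolding adj_def by (cases b) (simp; arith)

lemma adj_sym: "adj a b \<Longrightarrow> adj b a"
  by (simp add: adj_def abs_minus_commute)

definition edge_connected :: "(int \<times> int) set \<Rightarrow> bool" where
  "edge_connected A \<longleftrightarrow> A \<noteq> {} \<and>
     (\<forall>X. X \<subseteq> A \<and> X \<noteq> {} \<and> (\<forall>a\<in>X. \<forall>b\<in>A. adj a b \<longrightarrow> b \<in> X) \<longrightarrow> X = A)"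

lemma edge_connectedD:
  assumes "edge_connected A" "X \<subseteq> A" "X \<noteq> {}"
    and "\<And>a b. a \<in> X \<Longrightarrow> b \<in> A \<Longrightarrow> adj a b \<Longrightarrow> b \<in> X"
  shows "X = A"
  using assms unfolding edge_connected_def by meson

text \<open>The increment is the integral of \<open>2 x dy\<close> along the segment from \<open>a\<close> to \<open>b\<close>.\<close>
definition area_potential :: "(int \<times> int) set \<Rightarrow> bool" where
  "area_potential A \<longleftrightarrow> (\<exists>\<phi> :: int \<times> int \<Rightarrow> real. \<forall>a\<in>A. \<forall>b\<in>A. adj a b \<longrightarrow>
     \<phi> b - \<phi> a = of_int ((fst a + fst b) * (snd b - snd a)))"

text \<open>Around the four cell centres the form \<open>2 x dy\<close> integrates to 2, twice the
  area of the unit square they span, so no potential exists on them.\<close>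

lemma area_potential_no_block:
  assumes "area_potential A"
  shows "\<not> {(x, y), (x + 1, y), (x, y + 1), (x + 1, y + 1)} \<subseteq> A"
proof
  assume *: "{(x, y), (x + 1, y), (x, y + 1), (x + 1, y + 1)} \<subseteq> A"
  obtain \<phi> :: "int \<times> int \<Rightarrow> real" where
    \<phi>: "\<And>a b. a \<in> A \<Longrightarrow> b \<in> A \<Longrightarrow> adj a b \<Longrightarrow>
         \<phi> b - \<phi> a = of_int ((fst a + fst b) * (snd b - snd a))"
    using assms unfolding area_potential_def by blast
  have "\<phi> (x + 1, y) - \<phi> (x, y) = 0" "\<phi> (x + 1, y + 1) - \<phi> (x + 1, y) = 2 * of_int x + 2"
    "\<phi> (x + 1, y + 1) - \<phi> (x, y + 1) = 0" "\<phi> (x, y + 1) - \<phi> (x, y) = 2 * of_int x"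
    using * by (subst \<phi>; auto simp: adj_def)+
  then show False by linarith
qed

text \<open>Here \<open>u\<close> and \<open>v\<close> stand for the increments of a walk at two
  opposite corners of a cell, and \<open>s\<close> moves to the diagonal neighbour. A vertex shared
  by \<open>p\<close> and \<open>s p\<close> gives 2 in total, and so does \<open>u p\<close> at an
  unshared one; the remaining terms \<open>v p\<close> with \<open>t p\<close> outside
  \<open>K\<close> are positive and dropped.\<close>

lemma paired_shift_sum:
  fixes u v :: "'a \<Rightarrow> real"
  assumes fin: "finite K" and st: "\<And>p. t (s p) = p" "\<And>p. s (t p) = p"
    and u: "\<And>p. p \<in> K \<Longrightarrow> s p \<notin> K \<Longrightarrow> u p = 2"
    and v: "\<And>p. p \<in> K \<Longrightarrow> t p \<notin> K \<Longrightarrow> v p = 2"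
    and uv: "\<And>p. p \<in> K \<Longrightarrow> s p \<in> K \<Longrightarrow> u p + v (s p) = 2"
  shows "(\<Sum>p\<in>K. u p + v p) \<ge> 2 * real (card K)"
proof -
  let ?A = "{p\<in>K. s p \<in> K}" and ?B = "{p\<in>K. t p \<in> K}"
  have "(\<Sum>p\<in>K. u p) = (\<Sum>p\<in>?A. u p) + (\<Sum>p\<in>K - ?A. u p)"
    using fin by (subst sum.subset_diff[of ?A K]) auto
  also have "(\<Sum>p\<in>K - ?A. u p) = (\<Sum>p\<in>K - ?A. 2)"
    using u by (intro sum.cong) auto
  finally have 1: "(\<Sum>p\<in>K. u p) = (\<Sum>p\<in>?A. u p) + 2 * real (card (K - ?A))" by simp
  have "(\<Sum>p\<in>K. v p) = (\<Sum>p\<in>?B. v p) + (\<Sum>p\<in>K - ?B. v p)"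
    using fin by (subst sum.subset_diff[of ?B K]) auto
  also have "(\<Sum>p\<in>K - ?B. v p) = (\<Sum>p\<in>K - ?B. 2)"
    using v by (intro sum.cong) auto
  also have "(\<Sum>p\<in>?B. v p) = (\<Sum>p\<in>?A. v (s p))"
    by (rule sum.reindex_bij_witness[where i = s and j = t]) (auto simp: st)
  finally have 2: "(\<Sum>p\<in>K. v p) \<ge> (\<Sum>p\<in>?A. v (s p))" by simp
  have "(\<Sum>p\<in>?A. u p) + (\<Sum>p\<in>?A. v (s p)) = (\<Sum>p\<in>?A. 2)"
    unfolding sum.distrib[symmetric] by (intro sum.cong) (auto simp: uv)
  then have "(\<Sum>p\<in>?A. u p) + (\<Sum>p\<in>?A. v (s p)) = 2 * real (card ?A)" by simp
  moreover have "card K = card ?A + card (K - ?A)"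
    using fin card_Un_disjoint[of ?A "K - ?A"] by (simp add: Un_absorb1)
  ultimately show ?thesis using 1 2 by (simp add: sum.distrib)
qed

text \<open>
  The potential is evaluated along the counterclockwise walk through the tiles around \<open>K\<close>:
  its increments telescope to zero, while the potential form measures twice the enclosed area.
  At a vertex where two cells of \<open>K\<close> touch, the increments seen from the two cells cancel.
\<close>
lemma area_potential_no_isolated_cells:
  assumes pot: "area_potential A" and fin: "finite K"
    and nb: "\<And>p q. p \<in> K \<Longrightarrow> adj p q \<Longrightarrow> q \<in> A"
    and diag: "\<And>x y i j. (x, y) \<in> K \<Longrightarrow> \<bar>i\<bar> = 1 \<Longrightarrow> \<bar>j\<bar> = 1 \<Longrightarrow> (x + i, y + j) \<in> A \<union> K"
  shows "K = {}"
proof (rule ccontr)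
  assume "K \<noteq> {}"
  obtain \<phi> :: "int \<times> int \<Rightarrow> real" where
    \<phi>: "\<And>a b. a \<in> A \<Longrightarrow> b \<in> A \<Longrightarrow> adj a b \<Longrightarrow>
         \<phi> b - \<phi> a = of_int ((fst a + fst b) * (snd b - snd a))"
    using pot unfolding area_potential_def by blast
  have R: "(x + 1, y) \<in> A" and L: "(x - 1, y) \<in> A" and U: "(x, y + 1) \<in> A" and D: "(x, y - 1) \<in> A"
    if "(x, y) \<in> K" for x y
    using nb[OF that] by (auto simp: adj_iff)
  have hor: "\<phi> (x', y) = \<phi> (x, y)" if "(x, y) \<in> A" "(x', y) \<in> A" "\<bar>x - x'\<bar> = 1" for x x' y
    using \<phi>[OF that(1,2)] that(3) by (simp add: adj_def)
  have ver: "\<phi> (x, y + 1) - \<phi> (x, y) = 2 * of_int x" if "(x, y) \<in> A" "(x, y + 1) \<in> A" for x y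
    using \<phi>[OF that] by (simp add: adj_def)
  \<comment> \<open>Quarter turns around a cell: from its right to its upper, left, lower and again
    right neighbour. The terms \<open>2 * of_int x\<close> are chosen so that a turn through a tile
    at the corner gives exactly 2, while the four turns at one cell sum to 0.\<close>
  define d0 where "d0 = (\<lambda>(x, y). \<phi> (x, y + 1) - \<phi> (x + 1, y) - 2 * of_int x)"
  define d1 where "d1 = (\<lambda>(x, y). \<phi> (x - 1, y) - \<phi> (x, y + 1) + 2 * of_int x)"
  define d2 where "d2 = (\<lambda>(x, y). \<phi> (x, y - 1) - \<phi> (x - 1, y) + 2 * of_int x)"
  define d3 where "d3 = (\<lambda>(x, y). \<phi> (x + 1, y) - \<phi> (x, y - 1) - 2 * of_int x)"
  have a: "(\<Sum>p\<in>K. d0 p + d2 p) \<ge> 2 * real (card K)"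
  proof (rule paired_shift_sum[OF fin, where s = "\<lambda>(x, y). (x + 1, y + 1)" and t = "\<lambda>(x, y). (x - 1, y - 1)"],
      goal_cases)
    case (3 p)
    obtain x y where p: "p = (x, y)" by (cases p)
    have "(x + 1, y + 1) \<in> A" using diag[of x y 1 1] 3 p by auto
    then show ?case using 3 p R[of x y] U[of x y] ver[of "x + 1" y] hor[of x "y + 1" "x + 1"]
      by (simp add: d0_def)
  next
    case (4 p)
    obtain x y where p: "p = (x, y)" by (cases p)
    have "(x - 1, y - 1) \<in> A" using diag[of x y "-1" "-1"] 4 p by auto
    then show ?case using 4 p L[of x y] D[of x y] ver[of "x - 1" "y - 1"] hor[of x "y - 1" "x - 1"]
      by (simp add: d2_def)
  qed (auto simp: d0_def d2_def)
  have b: "(\<Sum>p\<in>K. d1 p + d3 p) \<ge> 2 * real (card K)"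
  proof (rule paired_shift_sum[OF fin, where s = "\<lambda>(x, y). (x - 1, y + 1)" and t = "\<lambda>(x, y). (x + 1, y - 1)"],
      goal_cases)
    case (3 p)
    obtain x y where p: "p = (x, y)" by (cases p)
    have "(x - 1, y + 1) \<in> A" using diag[of x y "-1" 1] 3 p by auto
    then show ?case using 3 p L[of x y] U[of x y] ver[of "x - 1" y] hor[of x "y + 1" "x - 1"]
      by (simp add: d1_def)
  next
    case (4 p)
    obtain x y where p: "p = (x, y)" by (cases p)
    have "(x + 1, y - 1) \<in> A" using diag[of x y 1 "-1"] 4 p by auto
    then show ?case using 4 p R[of x y] D[of x y] ver[of "x + 1" "y - 1"] hor[of x "y - 1" "x + 1"]
      by (simp add: d3_def)
  qed (auto simp: d1_def d3_def)
  have "(\<Sum>p\<in>K. d0 p + d2 p) + (\<Sum>p\<in>K. d1 p + d3 p) = (\<Sum>p\<in>K. 0)"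
    unfolding sum.distrib[symmetric]
    by (intro sum.cong) (auto simp: d0_def d1_def d2_def d3_def)
  moreover have "card K > 0" using \<open>K \<noteq> {}\<close> fin by (simp add: card_gt_0_iff)
  ultimately show False using a b by simp
qed

section \<open>Squares without a corner and their refinement to twice the size\<close>

definition frame :: "int \<Rightarrow> (int \<times> int) set \<Rightarrow> (int \<times> int) set" where
  "frame M H = {0..M} \<times> {0..M} - {(0, 0)} - H"

text \<open>Doubling fixes the origin, so the missing corner of a frame becomes the missing corner
  of the refined frame.\<close>

definition double :: "int \<times> int \<Rightarrow> int \<times> int" where
  "double p = (2 * fst p, 2 * snd p)"

definition odd_cells :: "int \<Rightarrow> (int \<times> int) set" where
  "odd_cells M = {p \<in> {0..2*M} \<times> {0..2*M}. odd (fst p) \<and> odd (snd p)}"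

text \<open>The margin keeps the neighbours of a hole inside the square and away from the missing
  corner, so all four of them are tiles of the frame.\<close>

definition separated :: "int \<Rightarrow> (int \<times> int) set \<Rightarrow> bool" where
  "separated M H \<longleftrightarrow> H \<subseteq> {1..M - 1} \<times> {1..M - 1} \<and> (\<forall>p\<in>H. \<forall>q\<in>H. \<not> adj p q)"

text \<open>The coordinatewise sum of \<open>a\<close> and \<open>b\<close> is the midpoint of
  \<open>double a\<close> and \<open>double b\<close>: refinement subdivides every edge.\<close>

lemma adj_double_midpoint:
  assumes "adj a b"
  shows "adj (double a) (fst a + fst b, snd a + snd b)" "adj (fst a + fst b, snd a + snd b) (double b)"
  using assms by (auto simp: adj_def double_def)

text \<open>A cell with exactly one odd coordinate is the midpoint of a doubled edge that runs in
  the direction of this coordinate.\<close>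

lemma mixed_parity_cell_cases:
  assumes "odd (x + y :: int)" "(x, y) \<in> {0..2*M} \<times> {0..2*M}"
  obtains a b where "adj a b" "a \<in> {0..M} \<times> {0..M}" "b \<in> {0..M} \<times> {0..M}"
    "(x, y) = (fst a + fst b, snd a + snd b)"
proof (cases "even x")
  case True
  then obtain i j where "x = 2 * i" "y = 2 * j + 1" using assms(1) by (auto elim!: evenE oddE)
  then show ?thesis using that[of "(i, j)" "(i, j + 1)"] assms(2) by (auto simp: adj_def)
next
  case False
  then obtain i j where "x = 2 * i + 1" "y = 2 * j" using assms(1) by (auto elim!: evenE oddE)
  then show ?thesis using that[of "(i, j)" "(i + 1, j)"] assms(2) by (auto simp: adj_def)
qed

lemma frame_refine_mixed_parity:
  assumes "odd (x + y)" "(x, y) \<in> {0..2*M} \<times> {0..2*M}"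
  shows "(x, y) \<in> frame (2*M) (odd_cells M \<union> double ` H)"
  using assms by (auto simp: frame_def odd_cells_def double_def)

lemma frame_refine_double_iff:
  "double p \<in> frame (2*M) (odd_cells M \<union> double ` H) \<longleftrightarrow> p \<in> frame M H"
proof -
  have "double p \<in> double ` H \<longleftrightarrow> p \<in> H"
    by (rule inj_image_mem_iff) (auto simp: inj_def double_def prod_eq_iff)
  then show ?thesis
    by (cases p) (auto simp: frame_def odd_cells_def double_def)
qed

lemma frame_refine_cases:
  assumes "z \<in> frame (2*M) (odd_cells M \<union> double ` H)"
  obtains p where "p \<in> frame M H" "z = double p"
  | x y where "z = (x, y)" "odd (x + y)" "(x, y) \<in> {0..2*M} \<times> {0..2*M}"
proof (cases "odd (fst z + snd z)")
  case True
  then show ?thesis using that(2)[of "fst z" "snd z"] assms by (auto simp: frame_def)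
next
  case False
  then have "even (fst z) \<and> even (snd z)" using assms by (auto simp: frame_def odd_cells_def)
  then have "z = double (fst z div 2, snd z div 2)" by (auto simp: double_def prod_eq_iff)
  then show ?thesis using that(1) assms frame_refine_double_iff by metis
qed

text \<open>The refined adjacency graph subdivides the old one and adds pendant cells: a midpoint
  always has an end in \<open>frame M H\<close>, because the removed cells, the origin included, are
  pairwise not adjacent.\<close>

lemma edge_connected_frame_refine:
  assumes sep: "separated M H" and con: "edge_connected (frame M H)"
  shows "edge_connected (frame (2*M) (odd_cells M \<union> double ` H))" (is "edge_connected ?A")
proof -
  have ex: "\<exists>p\<in>frame M H. adj (double p) (x, y)"
    if xy: "odd (x + y)" "(x, y) \<in> {0..2*M} \<times> {0..2*M}" for x y
  proof -
    obtain a b where ab: "adj a b" "a \<in> {0..M} \<times> {0..M}" "b \<in> {0..M} \<times> {0..M}"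
      "(x, y) = (fst a + fst b, snd a + snd b)"
      using mixed_parity_cell_cases[OF xy] by metis
    have "a \<in> frame M H \<or> b \<in> frame M H"
    proof (rule ccontr)
      assume "\<not> ?thesis"
      then have "a \<in> insert (0,0) H" "b \<in> insert (0,0) H" using ab by (auto simp: frame_def)
      then show False using ab(1) sep by (auto simp: separated_def adj_def)
    qed
    then show ?thesis using adj_double_midpoint[OF ab(1)] adj_sym ab(4) by metis
  qed
  show ?thesis
    unfolding edge_connected_def
  proof (intro conjI allI impI)
    obtain p where "p \<in> frame M H" using con unfolding edge_connected_def by blast
    then show "?A \<noteq> {}" using frame_refine_double_iff by blast
  next
    fix X assume X: "X \<subseteq> ?A \<and> X \<noteq> {} \<and> (\<forall>a\<in>X. \<forall>b\<in>?A. adj a b \<longrightarrow> b \<in> X)"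
    have "{p \<in> frame M H. double p \<in> X} = frame M H" (is "?Y = _")
    proof (rule edge_connectedD[OF con])
      obtain z where z: "z \<in> X" using X by blast
      then have "z \<in> ?A" using X by blast
      then show "?Y \<noteq> {}"
      proof (cases rule: frame_refine_cases)
        case (1 p) then show ?thesis using z by blast
      next
        case (2 x y)
        then obtain p where "p \<in> frame M H" "adj (double p) z" using ex by blast
        then show ?thesis using z X adj_sym frame_refine_double_iff by blast
      qed
    next
      fix a b assume *: "a \<in> ?Y" "b \<in> frame M H" "adj a b"
      let ?m = "(fst a + fst b, snd a + snd b)"
      have "odd (fst ?m + snd ?m)" using *(3) unfolding adj_def by (simp, presburger)
      then have "?m \<in> ?A" using * by (intro frame_refine_mixed_parity) (auto simp: frame_def)
      then have "?m \<in> X" using adj_double_midpoint[OF *(3)] X * by blast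
      then show "b \<in> ?Y" using adj_double_midpoint[OF *(3)] X * frame_refine_double_iff by blast
    qed auto
    then have Y: "double p \<in> X" if "p \<in> frame M H" for p using that by blast
    have "z \<in> X" if "z \<in> ?A" for z
      using that
    proof (cases rule: frame_refine_cases)
      case (1 p) then show ?thesis using Y by blast
    next
      case (2 x y)
      then obtain p where "p \<in> frame M H" "adj (double p) z" using ex by blast
      then show ?thesis using X Y that by blast
    qed
    then show "X = ?A" using X by blast
  qed
qed

text \<open>Adjacency changes the parity of \<open>x + y\<close>, while all cells of the refined
  hole set have even \<open>x + y\<close>.\<close>

lemma separated_refine:
  assumes "separated M H"
  shows "separated (2*M) (odd_cells M \<union> double ` H)"
proof -
  have "even (fst p + snd p)" if "p \<in> odd_cells M \<union> double ` H" for p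
    using that by (auto simp: odd_cells_def double_def)
  moreover have "odd (fst p + snd p + (fst q + snd q))" if "adj p q" for p q
    using that unfolding adj_def by presburger
  ultimately have "\<not> adj p q"
    if "p \<in> odd_cells M \<union> double ` H" "q \<in> odd_cells M \<union> double ` H" for p q
    using that by (meson even_add)
  moreover have "x \<in> {1..2*M-1}" if "x \<in> {0..2*M}" "odd x" for x :: int
  proof -
    have "x \<noteq> 0" "x \<noteq> 2*M" using that by auto
    then show ?thesis using that by auto
  qed
  then have "odd_cells M \<subseteq> {1..2*M-1} \<times> {1..2*M-1}" by (auto simp: odd_cells_def)
  moreover have "double ` H \<subseteq> {1..2*M-1} \<times> {1..2*M-1}"
    using assms by (fastforce simp: double_def separated_def)
  ultimately show ?thesis unfolding separated_def by blast
qed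

text \<open>The converse of refinement, in three stages: no hole has odd \<open>x + y\<close>; every
  cell with two odd coordinates is a hole; the remaining holes, halved, satisfy the same
  hypotheses.\<close>

lemma separated_frame_unrefine:
  assumes M: "M \<ge> 1" and sep: "separated (2*M) H"
    and con: "edge_connected (frame (2*M) H)" and pot: "area_potential (frame (2*M) H)"
  obtains H' where "H = odd_cells M \<union> double ` H'" "separated M H'"
    "edge_connected (frame M H')" "area_potential (frame M H')"
proof -
  let ?A = "frame (2*M) H"
  have H: "H \<subseteq> {1..2*M-1} \<times> {1..2*M-1}" and nadj: "\<And>p q. p \<in> H \<Longrightarrow> q \<in> H \<Longrightarrow> \<not> adj p q"
    using sep unfolding separated_def by auto
  have fin: "finite H" using H by (rule finite_subset) auto
  \<comment> \<open>Diagonal steps preserve the parity of \<open>x + y\<close>. So a diagonal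
    neighbour of a cell in \<open>?K\<close> is never the missing corner, and it is a tile or again
    in \<open>?K\<close>.\<close>
  have "{p\<in>H. odd (fst p + snd p)} = {}" (is "?K = _")
  proof (rule area_potential_no_isolated_cells[OF pot])
    fix p q assume pq: "p \<in> ?K" "adj p q"
    then have "q \<notin> H" using nadj by blast
    moreover have p: "fst p \<in> {1..2*M-1}" "snd p \<in> {1..2*M-1}" using H pq(1) by auto
    moreover have "fst q + snd q \<noteq> 0 \<and> fst q \<in> {0..2*M} \<and> snd q \<in> {0..2*M}"
      using p pq(2) unfolding adj_def by auto
    ultimately show "q \<in> ?A" by (cases q) (auto simp: frame_def)
  next
    fix x y i j :: int assume *: "(x, y) \<in> ?K" "\<bar>i\<bar> = 1" "\<bar>j\<bar> = 1"
    then have "odd (x + y)" "1 \<le> x" "x \<le> 2*M-1" "1 \<le> y" "y \<le> 2*M-1" using H by auto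
    moreover have "i = 1 \<or> i = -1" "j = 1 \<or> j = -1" using * by auto
    ultimately show "(x + i, y + j) \<in> ?A \<union> ?K" by (auto simp: frame_def)
  qed (use fin in auto)
  then have even: "even (fst p + snd p)" if "p \<in> H" for p using that by blast
  have oddA: "(x, y) \<in> ?A" if "odd (x + y)" "(x, y) \<in> {0..2*M} \<times> {0..2*M}" for x y
    using that even[of "(x, y)"] by (auto simp: frame_def)
  have midA: "(fst p + fst q, snd p + snd q) \<in> ?A"
    if "adj p q" "p \<in> {0..M} \<times> {0..M}" "q \<in> {0..M} \<times> {0..M}" for p q
  proof (rule oddA)
    show "odd (fst p + fst q + (snd p + snd q))" using that(1) unfolding adj_def by presburger
  qed (use that in auto)
  \<comment> \<open>\<open>X\<close> will consist of the tiles in \<open>E\<close> and their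
    neighbours of mixed parity. Once it is shown to be closed under adjacency, it exhausts the
    frame, and no tile can have two odd coordinates.\<close>
  define E where "E = {p \<in> ?A. even (fst p) \<and> even (snd p)}"
  define X where "X = E \<union> {q \<in> ?A. odd (fst q + snd q) \<and> (\<exists>p\<in>E. adj p q)}"
  have "X = ?A"
  proof (rule edge_connectedD[OF con])
    show "X \<subseteq> ?A" by (auto simp: X_def E_def)
    have "(2*M, 0) \<in> E" using M H by (auto simp: E_def frame_def)
    then show "X \<noteq> {}" by (auto simp: X_def)
  next
    fix a b assume *: "a \<in> X" "b \<in> ?A" "adj a b"
    have par: "odd (fst a + snd a + (fst b + snd b))" using *(3) unfolding adj_def by presburger
    show "b \<in> X"
    proof (cases "a \<in> E")
      case True
      then have "odd (fst b + snd b)" using par by (simp add: E_def)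
      then show ?thesis using True * unfolding X_def by blast
    next
      case False
      then obtain p where p: "p \<in> E" "adj p a" "odd (fst a + snd a)" "a \<in> ?A" using *(1) by (auto simp: X_def)
      have "even (fst b)"
      proof (rule ccontr)
        assume ob: "odd (fst b)"
        obtain x y px py bx byy where xy: "a = (x, y)" "p = (px, py)" "b = (bx, byy)" by (cases a, cases b, cases p)
        have bo: "odd bx" "odd byy" using ob par p(3) xy by auto
        have pe: "even px" "even py" using p(1) xy by (auto simp: E_def)
        \<comment> \<open>The fourth cell of the block spanned by the path \<open>p\<close>,
          \<open>a\<close>, \<open>b\<close>. Its coordinate sum is odd, as is that of
          \<open>a\<close>, so it is a tile and the block is full.\<close>
        let ?d = "(px + bx - x, py + byy - y)"
        have ap: "(x = px \<and> \<bar>y - py\<bar> = 1) \<or> (y = py \<and> \<bar>x - px\<bar> = 1)"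
          using p(2) xy by (auto simp: adj_def)
        have ab: "(x = bx \<and> \<bar>y - byy\<bar> = 1) \<or> (y = byy \<and> \<bar>x - bx\<bar> = 1)"
          using *(3) xy by (auto simp: adj_def)
        have box: "x \<in> {0..2*M}" "y \<in> {0..2*M}" "px \<in> {0..2*M}" "py \<in> {0..2*M}" "bx \<in> {0..2*M}" "byy \<in> {0..2*M}"
          using p(1,4) *(2) xy by (auto simp: E_def frame_def)
        have cs: "(x = px \<and> \<bar>y - py\<bar> = 1 \<and> y = byy \<and> \<bar>x - bx\<bar> = 1) \<or> (y = py \<and> \<bar>x - px\<bar> = 1 \<and> x = bx \<and> \<bar>y - byy\<bar> = 1)"
          using ap ab bo pe by auto
        then have "?d \<in> {0..2*M} \<times> {0..2*M}" using box by auto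
        moreover have "odd (px + bx - x + (py + byy - y))" using bo pe p(3) xy by auto
        ultimately have d: "?d \<in> ?A" by (intro oddA) auto
        have blk: "{(min px bx, min py byy), (min px bx + 1, min py byy),
                 (min px bx, min py byy + 1), (min px bx + 1, min py byy + 1)} \<subseteq> {a, b, p, ?d}"
          using cs
        proof (elim disjE conjE)
          assume c: "x = px" "\<bar>y - py\<bar> = 1" "y = byy" "\<bar>x - bx\<bar> = 1"
          have "py = y + 1 \<or> py = y - 1" "bx = x + 1 \<or> bx = x - 1" using c by auto
          then show ?thesis unfolding xy c(1)[symmetric] c(3)[symmetric]
            by (elim disjE) (simp_all add: min_def)
        next
          assume c: "y = py" "\<bar>x - px\<bar> = 1" "x = bx" "\<bar>y - byy\<bar> = 1"
          have "byy = y + 1 \<or> byy = y - 1" "px = x + 1 \<or> px = x - 1" using c by auto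
          then show ?thesis unfolding xy c(1)[symmetric] c(3)[symmetric]
            by (elim disjE) (simp_all add: min_def)
        qed
        have "{a, b, p, ?d} \<subseteq> ?A" using p(1,4) *(2) d unfolding E_def by blast
        with blk show False using area_potential_no_block[OF pot] by (meson subset_trans)
      qed
      then show ?thesis using par p(3) *(2) by (auto simp: X_def E_def)
    qed
  qed
  then have "\<not> (odd (fst p) \<and> odd (snd p))" if "p \<in> ?A" for p
    using that by (auto simp: X_def E_def)
  then have oddH: "odd_cells M \<subseteq> H" by (fastforce simp: odd_cells_def frame_def)
  define H' where "H' = {p. double p \<in> H}"
  have Heq: "H = odd_cells M \<union> double ` H'"
  proof
    show "H \<subseteq> odd_cells M \<union> double ` H'"
    proof
      fix z assume z: "z \<in> H"
      show "z \<in> odd_cells M \<union> double ` H'"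
      proof (cases "odd (fst z)")
        case True
        then have "odd (snd z)" using even[OF z] by simp
        then show ?thesis using True z H by (auto simp: odd_cells_def)
      next
        case False
        then have "even (snd z)" using even[OF z] by simp
        then have "z = double (fst z div 2, snd z div 2)" using False by (auto simp: double_def prod_eq_iff)
        then show ?thesis using z by (auto simp: H'_def)
      qed
    qed
  qed (use oddH H'_def in auto)
  have Aeq: "?A = frame (2*M) (odd_cells M \<union> double ` H')" using Heq by simp
  have H'sub: "H' \<subseteq> {1..M-1} \<times> {1..M-1}" using H by (auto simp: H'_def double_def)
  have "separated M H'"
    unfolding separated_def
  proof (intro conjI ballI notI H'sub)
    fix p q assume *: "p \<in> H'" "q \<in> H'" "adj p q"
    let ?m = "(fst p + fst q, snd p + snd q)"
    have "p \<in> {0..M} \<times> {0..M}" "q \<in> {0..M} \<times> {0..M}" using * H'sub by auto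
    then have mA: "?m \<in> ?A" using midA *(3) by blast
    \<comment> \<open>Besides \<open>double p\<close> and \<open>double q\<close>, the midpoint has
      only neighbours with two odd coordinates, which are never tiles. So it would be an isolated
      tile.\<close>
    have "{?m} = ?A"
    proof (rule edge_connectedD[OF con])
      fix a b assume **: "a \<in> {?m}" "b \<in> ?A" "adj a b"
      have "b = double p \<or> b = double q \<or> (odd (fst b) \<and> odd (snd b))"
      proof -
        obtain x y where p: "p = (x, y)" by (cases p)
        have "q = (x + 1, y) \<or> q = (x - 1, y) \<or> q = (x, y + 1) \<or> q = (x, y - 1)"
          using *(3) unfolding p adj_iff .
        then show ?thesis using **(1,3) unfolding p
          by (elim disjE) (simp_all add: adj_iff double_def, (elim disjE; simp)+)
      qed
      moreover have "b \<notin> odd_cells M" "b \<noteq> double p" "b \<noteq> double q"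
        using **(2) Heq * by (auto simp: frame_def)
      moreover have "b \<in> {0..2*M} \<times> {0..2*M}" using **(2) by (auto simp: frame_def)
      ultimately show "b \<in> {?m}" by (auto simp: odd_cells_def)
    qed (use mA in auto)
    moreover have "(2*M, 0) \<in> ?A" "(0, 2*M) \<in> ?A" using M H by (auto simp: frame_def)
    ultimately show False using M by (metis singletonD prod.inject zero_neq_numeral mult_eq_0_iff not_one_le_zero)
  qed
  moreover have "edge_connected (frame M H')"
    unfolding edge_connected_def
  proof (intro conjI allI impI)
    have "(M, 0) \<in> frame M H'" using M H'sub by (auto simp: frame_def)
    then show "frame M H' \<noteq> {}" by blast
  next
    fix Y assume Y: "Y \<subseteq> frame M H' \<and> Y \<noteq> {} \<and> (\<forall>a\<in>Y. \<forall>b\<in>frame M H'. adj a b \<longrightarrow> b \<in> Y)"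
    \<comment> \<open>The lift of \<open>Y\<close> to the refined frame, together with the midpoints
      of incident edges.\<close>
    define Z where "Z = {z \<in> ?A. z \<in> double ` Y \<or> odd (fst z + snd z) \<and> (\<exists>p\<in>Y. adj (double p) z)}"
    have "Z = ?A"
    proof (rule edge_connectedD[OF con])
      show "Z \<subseteq> ?A" by (auto simp: Z_def)
      obtain p where "p \<in> Y" using Y by blast
      then have "double p \<in> Z" using Y Aeq frame_refine_double_iff by (auto simp: Z_def)
      then show "Z \<noteq> {}" by blast
    next
      fix a b assume *: "a \<in> Z" "b \<in> ?A" "adj a b"
      have par: "odd (fst a + snd a + (fst b + snd b))" using *(3) unfolding adj_def by presburger
      show "b \<in> Z"
      proof (cases "a \<in> double ` Y")
        case True
        then have "odd (fst b + snd b)" using par by (auto simp: double_def)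
        then show ?thesis using True * by (auto simp: Z_def)
      next
        case False
        then obtain p where p: "p \<in> Y" "adj (double p) a" "odd (fst a + snd a)" using *(1) by (auto simp: Z_def)
        have "b \<in> frame (2*M) (odd_cells M \<union> double ` H')" using *(2) Aeq by simp
        then show ?thesis
        proof (cases rule: frame_refine_cases)
          case (1 q)
          have "q = p \<or> adj p q"
          proof -
            obtain x y x' y' where xy: "p = (x, y)" "q = (x', y')" by (cases p, cases q)
            have "a = (2*x + 1, 2*y) \<or> a = (2*x - 1, 2*y) \<or> a = (2*x, 2*y + 1) \<or> a = (2*x, 2*y - 1)"
              using p(2) unfolding xy double_def by (simp add: adj_iff)
            then have "(x' = x \<and> y' = y) \<or> (x' = x + 1 \<and> y' = y) \<or> (x' = x - 1 \<and> y' = y)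
                \<or> (x' = x \<and> y' = y + 1) \<or> (x' = x \<and> y' = y - 1)"
            proof (elim disjE)
              assume "a = (2*x + 1, 2*y)"
              then show ?thesis using *(3) unfolding 1(2) xy by (simp add: adj_iff double_def) presburger
            next
              assume "a = (2*x - 1, 2*y)"
              then show ?thesis using *(3) unfolding 1(2) xy by (simp add: adj_iff double_def) presburger
            next
              assume "a = (2*x, 2*y + 1)"
              then show ?thesis using *(3) unfolding 1(2) xy by (simp add: adj_iff double_def) presburger
            next
              assume "a = (2*x, 2*y - 1)"
              then show ?thesis using *(3) unfolding 1(2) xy by (simp add: adj_iff double_def) presburger
            qed
            then show ?thesis unfolding xy adj_iff by auto
          qed
          then have "q \<in> Y" using Y p 1 by blast
          then show ?thesis using 1 *(2) by (auto simp: Z_def)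
        next
          case (2 x y)
          then show ?thesis using par p(3) by simp
        qed
      qed
    qed
    have "p \<in> Y" if "p \<in> frame M H'" for p
    proof -
      have "double p \<in> Z" using that \<open>Z = ?A\<close> Aeq frame_refine_double_iff by blast
      then have "double p \<in> double ` Y" by (auto simp: Z_def double_def)
      then show ?thesis by (auto simp: double_def prod_eq_iff)
    qed
    then have "frame M H' \<subseteq> Y" by blast
    then show "Y = frame M H'" using Y by blast
  qed
  moreover have "area_potential (frame M H')"
  proof -
    obtain \<phi> :: "int \<times> int \<Rightarrow> real" where
      \<phi>: "\<And>a b. a \<in> ?A \<Longrightarrow> b \<in> ?A \<Longrightarrow> adj a b \<Longrightarrow>
           \<phi> b - \<phi> a = of_int ((fst a + fst b) * (snd b - snd a))"
      using pot unfolding area_potential_def by blast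
    \<comment> \<open>The increments over the two halves of a doubled edge add up; the factor 4 is
      the scaling of area under doubling.\<close>
    have "\<phi> (double b) / 4 - \<phi> (double a) / 4 = of_int ((fst a + fst b) * (snd b - snd a))"
      if *: "a \<in> frame M H'" "b \<in> frame M H'" "adj a b" for a b
    proof -
      let ?m = "(fst a + fst b, snd a + snd b)"
      have m: "?m \<in> ?A" using * by (intro midA) (auto simp: frame_def)
      have d: "double a \<in> ?A" "double b \<in> ?A" using * Aeq frame_refine_double_iff by auto
      have "\<phi> (double b) - \<phi> (double a) =
          of_int ((2 * fst a + (fst a + fst b)) * (snd b - snd a) + (fst a + fst b + 2 * fst b) * (snd b - snd a))"
        using \<phi>[OF d(1) m adj_double_midpoint(1)[OF *(3)]] \<phi>[OF m d(2) adj_double_midpoint(2)[OF *(3)]]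
        by (simp add: double_def algebra_simps)
      also have "\<dots> = 4 * of_int ((fst a + fst b) * (snd b - snd a))"
        by (simp add: algebra_simps)
      finally show ?thesis by simp
    qed
    then show ?thesis
      unfolding area_potential_def by (intro exI[of _ "\<lambda>a. \<phi> (double a) / 4"] ballI impI)
  qed
  ultimately show ?thesis by (intro that[OF Heq])
qed

section \<open>The recursive hole pattern, its uniqueness and its size\<close>

fun hole_pattern :: "nat \<Rightarrow> (int \<times> int) set" where
  "hole_pattern 0 = {}"
| "hole_pattern (Suc l) = odd_cells (2 ^ l) \<union> double ` hole_pattern l"

lemma separated_hole_pattern: "separated (2 ^ l) (hole_pattern l)"
  by (induction l) (use separated_refine in \<open>auto simp: separated_def[of 1]\<close>)

lemma edge_connected_hole_pattern: "edge_connected (frame (2 ^ l) (hole_pattern l))"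
proof (induction l)
  case 0
  have [simp]: "frame 1 {} = {(0,1),(1,0),(1,1)}" 
    by (auto simp: frame_def)
  have "adj (0,1) (1,1)" "adj (1,1) (1,0)" "adj (1,1) (0,1)" "adj (1,0) (1,1)" by (auto simp: adj_def)
  then show ?case
    unfolding edge_connected_def by auto
next
  case (Suc l)
  then show ?case using edge_connected_frame_refine[OF separated_hole_pattern] by simp
qed

text \<open>Repeated halving ends at \<open>M = 1\<close>, where the range \<open>{1..M - 1}\<close>
  for hole coordinates is empty.\<close>

lemma hole_pattern_unique:
  assumes "separated (2 ^ l) H" "edge_connected (frame (2 ^ l) H)" "area_potential (frame (2 ^ l) H)"
  shows "H = hole_pattern l"
  using assms
proof (induction l arbitrary: H)
  case 0
  then show ?case by (auto simp: separated_def)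
next
  case (Suc l)
  obtain H' where "H = odd_cells (2 ^ l) \<union> double ` H'" "separated (2 ^ l) H'"
    "edge_connected (frame (2 ^ l) H')" "area_potential (frame (2 ^ l) H')"
    using separated_frame_unrefine[of "2 ^ l" H] Suc.prems by auto
  then show ?case using Suc.IH[of H'] by simp
qed

lemma card_odd_cells: "M \<ge> 0 \<Longrightarrow> card (odd_cells M) = nat (M * M)"
proof -
  assume M: "M \<ge> 0"
  have "odd_cells M = (\<lambda>(i, j). (2 * i + 1, 2 * j + 1)) ` ({0..<M} \<times> {0..<M})"
    by (auto simp: odd_cells_def image_iff elim!: oddE)
  moreover have "inj_on (\<lambda>(i, j). (2 * i + 1, 2 * j + 1 :: int)) ({0..<M} \<times> {0..<M})"
    by (auto simp: inj_on_def)
  ultimately show ?thesis using M by (simp add: card_image nat_mult_distrib)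
qed

lemma finite_hole_pattern: "finite (hole_pattern l)"
  using separated_hole_pattern[of l] unfolding separated_def by (meson finite_SigmaI finite_atLeastAtMost_int finite_subset)

text \<open>Passing from level \<open>l\<close> to the next adds \<open>4 ^ l\<close> cells. The
  additive form avoids subtraction and division of naturals.\<close>

lemma card_hole_pattern: "3 * card (hole_pattern l) + 1 = 4 ^ l"
proof (induction l)
  case (Suc l)
  have "card (hole_pattern (Suc l)) = card (odd_cells (2 ^ l)) + card (double ` hole_pattern l)"
    using finite_hole_pattern[of "Suc l"] by (simp, subst card_Un_disjoint) (auto simp: odd_cells_def double_def)
  also have "card (double ` hole_pattern l) = card (hole_pattern l)"
    by (rule card_image) (auto simp: inj_on_def double_def prod_eq_iff)
  also have "card (odd_cells (2 ^ l)) = 4 ^ l"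
    by (simp add: card_odd_cells nat_power_eq flip: power_mult_distrib)
  finally show ?case using Suc.IH by simp
qed simp

subsection \<open>Trees and boundary counts\<close>

text \<open>Ordered pairs, so each edge counts twice and a tree on \<open>n\<close> cells has
  \<open>2 * n - 2\<close> of them.\<close>

definition adj_pairs :: "(int \<times> int) set \<Rightarrow> ((int \<times> int) \<times> (int \<times> int)) set" where
  "adj_pairs S = {(a, b). a \<in> S \<and> b \<in> S \<and> adj a b}"

lemma finite_adj_pairs: "finite S \<Longrightarrow> finite (adj_pairs S)"
  by (rule finite_subset[of _ "S \<times> S"]) (auto simp: adj_pairs_def)

lemma card_adj_pairs_insert:
  assumes "finite S" "x \<notin> S"
  shows "card (adj_pairs (insert x S)) = card (adj_pairs S) + 2 * card {b \<in> S. adj x b}"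
proof -
  let ?N = "{b \<in> S. adj x b}"
  have "\<not> adj x x" by (simp add: adj_def)
  then have "adj_pairs (insert x S) = adj_pairs S \<union> (Pair x ` ?N \<union> (\<lambda>b. (b, x)) ` ?N)"
    by (auto simp: adj_pairs_def dest: adj_sym)
  also have "card \<dots> = card (adj_pairs S) + card (Pair x ` ?N \<union> (\<lambda>b. (b, x)) ` ?N)"
    using assms finite_adj_pairs by (intro card_Un_disjoint) (auto simp: adj_pairs_def)
  also have "card (Pair x ` ?N \<union> (\<lambda>b. (b, x)) ` ?N) = card (Pair x ` ?N) + card ((\<lambda>b. (b, x)) ` ?N)"
    using assms by (intro card_Un_disjoint) auto
  also have "\<dots> = 2 * card ?N" by (simp add: card_image inj_on_def)
  finally show ?thesis .
qed

text \<open>The form \<open>\<omega>\<close> is arbitrary because \<open>2 x dy\<close> will be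
  pulled back along lattice symmetries, which do not preserve it.\<close>

definition has_potential :: "(int \<times> int \<Rightarrow> int \<times> int \<Rightarrow> real) \<Rightarrow> (int \<times> int) set \<Rightarrow> bool" where
  "has_potential \<omega> S \<longleftrightarrow> (\<exists>\<phi> :: int \<times> int \<Rightarrow> real. \<forall>a\<in>S. \<forall>b\<in>S. adj a b \<longrightarrow> \<phi> b - \<phi> a = \<omega> a b)"

text \<open>Grow a subset from one cell by adding adjacent cells. Each new cell brings at least one
  edge, that is, two ordered pairs. In the case of equality it always brings exactly one, and the
  potential extends along this edge without any compatibility condition.\<close>

lemma edge_connected_tree_potential:
  assumes fin: "finite A" and con: "edge_connected A"
    and anti: "\<And>a b. \<omega> b a = - \<omega> a b"
  shows "card (adj_pairs A) + 2 \<ge> 2 * card A \<and>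
    (card (adj_pairs A) + 2 = 2 * card A \<longrightarrow> has_potential \<omega> A)"
proof -
  let ?P = "\<lambda>S. card (adj_pairs S) + 2 \<ge> 2 * card S \<and>
    (card (adj_pairs S) + 2 = 2 * card S \<longrightarrow> has_potential \<omega> S)"
  have step: "?P (insert x S)" if S: "?P S" "finite S" and x: "x \<notin> S" "s \<in> S" "adj x s" for x s S
  proof -
    let ?N = "{b \<in> S. adj x b}"
    have N: "s \<in> ?N" "finite ?N" using S x by auto
    then have "card ?N > 0" using card_gt_0_iff by blast
    moreover have "card (adj_pairs (insert x S)) = card (adj_pairs S) + 2 * card ?N"
      using card_adj_pairs_insert[OF S(2) x(1)] .
    moreover have "has_potential \<omega> (insert x S)" if "card ?N = 1" "has_potential \<omega> S"
    proof -
      have "?N = {s}" using that(1) N by (metis card_1_singletonE singletonD)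
      then have uniq: "b = s" if "b \<in> S" "adj x b" for b using that by auto
      obtain \<phi> where \<phi>: "\<And>a b. a \<in> S \<Longrightarrow> b \<in> S \<Longrightarrow> adj a b \<Longrightarrow> \<phi> b - \<phi> a = \<omega> a b"
        using \<open>has_potential \<omega> S\<close> unfolding has_potential_def by blast
      have "\<not> adj x x" by (simp add: adj_def)
      then have "(\<phi>(x := \<phi> s - \<omega> x s)) b - (\<phi>(x := \<phi> s - \<omega> x s)) a = \<omega> a b"
        if "a \<in> insert x S" "b \<in> insert x S" "adj a b" for a b
      proof (cases "a = x")
        case True
        then have "b \<in> S" "b \<noteq> x" using that \<open>\<not> adj x x\<close> by auto
        moreover have "b = s" using uniq[of b] calculation that True by blast
        ultimately show ?thesis using True by simp
      next
        case a: False
        show ?thesis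
        proof (cases "b = x")
          case True
          then have "a = s" using a that uniq[of a] adj_sym by blast
          then show ?thesis using a True anti[of x s] by simp
        next
          case False
          then show ?thesis using a that \<phi> by simp
        qed
      qed
      then show ?thesis unfolding has_potential_def by blast
    qed
    ultimately show ?thesis using S(1) finite_subset x S(2) by (auto simp: le_Suc_eq)
  qed
  obtain c where c: "c \<in> A" using con unfolding edge_connected_def by blast
  have "?P A" if "S \<subseteq> A" "S \<noteq> {}" "?P S" for S
    using that
  proof (induction "card (A - S)" arbitrary: S rule: less_induct)
    case less
    show ?case
    proof (cases "S = A")
      case False
      have "\<exists>a\<in>S. \<exists>b\<in>A. adj a b \<and> b \<notin> S"
      proof (rule ccontr)
        assume "\<not> ?thesis"
        then have "S = A" by (intro edge_connectedD[OF con less.prems(1,2)]) blast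
        then show False using False by simp
      qed
      then obtain a b where ab: "a \<in> S" "b \<in> A" "adj a b" "b \<notin> S" by blast
      have "?P (insert b S)"
        using step[OF less.prems(3) finite_subset[OF less.prems(1) fin] ab(4,1) adj_sym[OF ab(3)]] .
      moreover have "A - insert b S \<subset> A - S" using ab by blast
      then have "card (A - insert b S) < card (A - S)" using fin by (intro psubset_card_mono) auto
      ultimately show ?thesis using less.hyps[of "insert b S"] less.prems(1) ab(2) by blast
    qed (use less.prems in simp)
  qed
  moreover have "?P {c}"
    by (auto simp: has_potential_def adj_pairs_def adj_def)
  ultimately show ?thesis using c by blast
qed

section \<open>Boundary edges facing a given direction\<close>

definition per :: "int \<times> int \<Rightarrow> (int \<times> int) set \<Rightarrow> nat" where
  "per d S = card {a \<in> S. a + d \<notin> S}"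

text \<open>Opposite directions have equally many boundary edges: the shift by \<open>d\<close>
  matches the cells that do have a neighbour in \<open>S\<close> on the respective side.\<close>

lemma per_minus:
  assumes "finite S"
  shows "card {a \<in> S. a - d \<notin> S} = per d S"
proof -
  have "card {a \<in> S. a - d \<in> S} = card {a \<in> S. a + d \<in> S}"
    by (rule bij_betw_same_card[of "\<lambda>a. a - d"], rule bij_betwI[where g = "\<lambda>a. a + d"]) auto
  moreover have "card S = card {a \<in> S. a + e \<in> S} + card {a \<in> S. a + e \<notin> S}" for e
    using assms by (subst card_Un_disjoint[symmetric]) (auto intro: arg_cong[of _ _ card])
  from this[of d] this[of "- d"] have "card {a \<in> S. a - d \<in> S} + card {a \<in> S. a - d \<notin> S} = 
     card {a \<in> S. a + d \<in> S} + card {a \<in> S. a + d \<notin> S}" by simp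
  ultimately show ?thesis by (simp add: per_def)
qed

text \<open>Each of the \<open>4 * card S\<close> sides of cells either gives an ordered adjacent
  pair or is a boundary edge; opposite directions are merged by \<open>per_minus\<close>.\<close>

lemma card_adj_pairs_per:
  assumes "finite S"
  shows "card (adj_pairs S) + 2 * (per (1, 0) S + per (0, 1) S) = 4 * card S"
proof -
  let ?E = "\<lambda>d. (\<lambda>a. (a, a + d)) ` {a \<in> S. a + d \<in> S}"
  have eq: "adj_pairs S = ?E (1,0) \<union> (?E (-1,0) \<union> (?E (0,1) \<union> ?E (0,-1)))"
    by (auto simp: adj_pairs_def adj_iff image_iff)
  have "card (adj_pairs S) = card (?E (1,0)) + (card (?E (-1,0)) + (card (?E (0,1)) + card (?E (0,-1))))"
    unfolding eq using assms by (subst card_Un_disjoint; auto)+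
  moreover have "card (?E d) + card {a \<in> S. a + d \<notin> S} = card S" for d
  proof -
    have "card (?E d) = card {a \<in> S. a + d \<in> S}" by (rule card_image) (auto simp: inj_on_def)
    then show ?thesis
      using assms by (simp, subst card_Un_disjoint[symmetric]) (auto intro: arg_cong[of _ _ card])
  qed
  note this[of "(1,0)"] this[of "(-1,0)"] this[of "(0,1)"] this[of "(0,-1)"]
  moreover have "card {a \<in> S. a + (-1,0) \<notin> S} = per (1,0) S" "card {a \<in> S. a + (0,-1) \<notin> S} = per (0,1) S"
    using per_minus[OF assms, of "(1,0)"] per_minus[OF assms, of "(0,1)"]
    by (simp_all only: diff_conv_add_uminus uminus_prod_def fst_conv snd_conv) simp_all
  ultimately show ?thesis by (simp add: per_def)
qed

text \<open>Going up from any cell of a column reaches the top of a run, which carries an upper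
  boundary edge. In the case of equality each column has a single run, so it is an interval.\<close>

lemma card_fst_le_per:
  assumes fin: "finite S"
  shows "card (fst ` S) \<le> per (0, 1) S"
    and "card (fst ` S) = per (0, 1) S \<Longrightarrow> (x, y) \<in> S \<Longrightarrow> (x, z) \<in> S \<Longrightarrow> y \<le> w \<Longrightarrow> w \<le> z \<Longrightarrow> (x, w) \<in> S"
proof -
  let ?T = "{a \<in> S. a + (0, 1) \<notin> S}"
  have top: "\<exists>t\<ge>y. (x, t) \<in> ?T \<and> (\<forall>s. y \<le> s \<and> s \<le> t \<longrightarrow> (x, s) \<in> S)" if xy: "(x, y) \<in> S" for x y
  proof -
    let ?U = "{u. u \<ge> y \<and> (x, u) \<notin> S}"
    define b where "b = Max (snd ` S)"
    have "u \<le> b" if "(x, u) \<in> S" for u using that fin by (force simp: b_def intro: Max_ge)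
    then have "(x, b + 1) \<notin> S" "b + 1 \<ge> y" using xy by fastforce+
    then have ex: "\<exists>n. (x, y + int n) \<notin> S" by (intro exI[of _ "nat (b + 1 - y)"]) simp
    define n where "n = (LEAST n. (x, y + int n) \<notin> S)"
    have n: "(x, y + int n) \<notin> S" unfolding n_def by (rule LeastI_ex[OF ex])
    have lt: "(x, y + int k) \<in> S" if "k < n" for k using not_less_Least[of k] that n_def by blast
    have "n > 0" using n xy by (cases n) auto
    then have "(x, y + int n - 1) \<in> S" using lt[of "n - 1"] by (simp add: algebra_simps)
    moreover have "(x, s) \<in> S" if "y \<le> s" "s \<le> y + int n - 1" for s
      using lt[of "nat (s - y)"] that by simp
    ultimately show ?thesis using n \<open>n > 0\<close> by (intro exI[of _ "y + int n - 1"]) auto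
  qed
  have img: "fst ` S = fst ` ?T" using top by force
  have finT: "finite ?T" using fin by simp
  show "card (fst ` S) \<le> per (0, 1) S" unfolding img per_def by (rule card_image_le[OF finT])
  assume eq: "card (fst ` S) = per (0, 1) S" and xyz: "(x, y) \<in> S" "(x, z) \<in> S" "y \<le> w" "w \<le> z"
  have inj: "inj_on fst ?T" using eq img finT by (intro eq_card_imp_inj_on) (auto simp: per_def)
  obtain t where t: "t \<ge> y" "(x, t) \<in> ?T" "\<forall>s. y \<le> s \<and> s \<le> t \<longrightarrow> (x, s) \<in> S" using top[OF xyz(1)] by blast
  obtain t' where t': "t' \<ge> z" "(x, t') \<in> ?T" using top[OF xyz(2)] by blast
  have "t = t'" using inj_onD[OF inj _ t(2) t'(2)] by simp
  then show "(x, w) \<in> S" using t t' xyz by simp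
qed

lemma per_swap:
  "per (1, 0) S = per (0, 1) (prod.swap ` S)"
proof -
  have "{a \<in> prod.swap ` S. a + (0, 1) \<notin> prod.swap ` S} = prod.swap ` {a \<in> S. a + (1, 0) \<notin> S}"
    by auto
  then show ?thesis by (simp add: per_def card_image)
qed

lemma card_snd_le_per:
  assumes fin: "finite S"
  shows "card (snd ` S) \<le> per (1, 0) S"
    and "card (snd ` S) = per (1, 0) S \<Longrightarrow> (y, x) \<in> S \<Longrightarrow> (z, x) \<in> S \<Longrightarrow> y \<le> w \<Longrightarrow> w \<le> z \<Longrightarrow> (w, x) \<in> S"
proof -
  have img: "snd ` S = fst ` prod.swap ` S" by (simp add: image_image)
  have fin': "finite (prod.swap ` S)" using fin by simp
  show "card (snd ` S) \<le> per (1, 0) S" 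
    unfolding img per_swap by (rule card_fst_le_per(1)[OF fin'])
  assume "card (snd ` S) = per (1, 0) S" "(y, x) \<in> S" "(z, x) \<in> S" "y \<le> w" "w \<le> z"
  then have "(x, w) \<in> prod.swap ` S"
    unfolding img per_swap by (intro card_fst_le_per(2)[OF fin', of x y z w]) auto
  then show "(w, x) \<in> S" by auto
qed

text \<open>A combinatorial substitute for the holes of \<open>A\<close>; the sets \<open>C i\<close> need not be connected.\<close>
definition hole_family :: "(int \<times> int) set \<Rightarrow> 'i set \<Rightarrow> ('i \<Rightarrow> (int \<times> int) set) \<Rightarrow> bool" where
  "hole_family A I C \<longleftrightarrow> finite I \<and> disjoint_family_on C I \<and>
     (\<forall>i\<in>I. finite (C i) \<and> C i \<noteq> {} \<and> C i \<inter> A = {} \<and> (\<forall>a\<in>C i. \<forall>b. adj a b \<longrightarrow> b \<in> C i \<union> A))"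

text \<open>Beyond a boundary edge of \<open>A\<close> lies either the outside of the filled set or
  a cell of exactly one \<open>C i\<close>. In the second case it is also an edge of
  \<open>C i\<close> facing the opposite way, and \<open>per_minus\<close> turns it around.\<close>

lemma per_filled:
  assumes fin: "finite A" and hf: "hole_family A I C" and d: "\<And>a. adj a (a + d)"
  shows "per d A = per d (A \<union> (\<Union>i\<in>I. C i)) + (\<Sum>i\<in>I. per d (C i))"
proof -
  let ?F = "A \<union> (\<Union>i\<in>I. C i)"
  let ?B = "\<lambda>i. (\<lambda>c. c - d) ` {c \<in> C i. c - d \<notin> C i}"
  have finI: "finite I" and disj: "disjoint_family_on C I" 
    and finC: "\<And>i. i \<in> I \<Longrightarrow> finite (C i)" and CA: "\<And>i. i \<in> I \<Longrightarrow> C i \<inter> A = {}"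
    and cl: "\<And>i a b. i \<in> I \<Longrightarrow> a \<in> C i \<Longrightarrow> adj a b \<Longrightarrow> b \<in> C i \<union> A"
    using hf unfolding hole_family_def by blast+
  have d': "adj a (a - d)" for a using d[of "a - d"] adj_sym by simp
  have 1: "{a \<in> A. a + d \<notin> A} = {a \<in> ?F. a + d \<notin> ?F} \<union> (\<Union>i\<in>I. ?B i)"
  proof (intro equalityI subsetI)
    fix a assume a: "a \<in> {a \<in> A. a + d \<notin> A}"
    show "a \<in> {a \<in> ?F. a + d \<notin> ?F} \<union> (\<Union>i\<in>I. ?B i)"
    proof (cases "a + d \<in> ?F")
      case True
      then obtain i where i: "i \<in> I" "a + d \<in> C i" using a by blast
      then have "a \<notin> C i" using CA a by blast
      then have "a \<in> ?B i" using i(2) by (intro image_eqI[of _ _ "a + d"]) auto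
      then show ?thesis using i by blast
    qed (use a in auto)
  next
    fix a assume "a \<in> {a \<in> ?F. a + d \<notin> ?F} \<union> (\<Union>i\<in>I. ?B i)"
    then consider "a \<in> ?F" "a + d \<notin> ?F" | i where "i \<in> I" "a + d \<in> C i" "a \<notin> C i" by auto
    then show "a \<in> {a \<in> A. a + d \<notin> A}"
    proof cases
      case 1
      then show ?thesis using cl[OF _ _ d] by blast
    next
      case 2
      have "adj (a + d) a" using d[of a] adj_sym by blast
      then show ?thesis using cl[OF 2(1,2)] 2 CA by blast
    qed
  qed
  have "card {a \<in> A. a + d \<notin> A} = card {a \<in> ?F. a + d \<notin> ?F} + card (\<Union>i\<in>I. ?B i)"
    unfolding 1 using fin finI finC by (intro card_Un_disjoint) auto
  also have "card (\<Union>i\<in>I. ?B i) = (\<Sum>i\<in>I. card (?B i))"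
  proof (rule card_UN_disjoint[OF finI])
    show "\<forall>i\<in>I. \<forall>j\<in>I. i \<noteq> j \<longrightarrow> ?B i \<inter> ?B j = {}"
      using disj unfolding disjoint_family_on_def by fastforce
  qed (use finC in auto)
  also have "\<dots> = (\<Sum>i\<in>I. per d (C i))"
    using per_minus finC by (intro sum.cong) (simp_all add: card_image inj_on_def)
  finally show ?thesis by (simp add: per_def)
qed

subsection \<open>Topology of regions\<close>

definition open_tile :: "int \<times> int \<Rightarrow> (real \<times> real) set" where
  "open_tile c = interior (tile c)"

lemma mem_tile:
  "z \<in> tile c \<longleftrightarrow> of_int (fst c) \<le> fst z \<and> fst z \<le> of_int (fst c) + 1 \<and>
     of_int (snd c) \<le> snd z \<and> snd z \<le> of_int (snd c) + 1"
  by (cases z) (auto simp: tile_def cbox_Pair_eq)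

lemma mem_open_tile:
  "z \<in> open_tile c \<longleftrightarrow> of_int (fst c) < fst z \<and> fst z < of_int (fst c) + 1 \<and>
     of_int (snd c) < snd z \<and> snd z < of_int (snd c) + 1"
  by (cases z) (auto simp: open_tile_def tile_def mem_box Basis_prod_def)

lemma open_tile_subset_tile: "open_tile c \<subseteq> tile c"
  by (simp add: open_tile_def interior_subset)

lemma open_open_tile: "open (open_tile c)"
  by (simp add: open_tile_def)

lemma center_in_open_tile: "(of_int (fst c) + 1/2, of_int (snd c) + 1/2) \<in> open_tile c"
  by (simp add: mem_open_tile)

lemma connected_open_tile: "connected (open_tile c)"
  by (simp add: open_tile_def tile_def convex_connected)

lemma tile_eq_closure: "tile c = closure (open_tile c)"
proof -
  have "box (real_of_int (fst c), real_of_int (snd c)) (real_of_int (fst c) + 1, real_of_int (snd c) + 1) \<noteq> {}"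
    by (simp add: box_ne_empty Basis_prod_def)
  from closure_box[OF this] show ?thesis by (simp add: open_tile_def tile_def)
qed

lemma tile_inter_open_tile:
  assumes "z \<in> open_tile c" "z \<in> tile d"
  shows "d = c"
  using assms by (auto simp: mem_tile mem_open_tile prod_eq_iff)

lemma mem_tile_floor: "z \<in> tile (\<lfloor>fst z\<rfloor>, \<lfloor>snd z\<rfloor>)"
  by (simp add: mem_tile)

lemma open_tile_region_iff: "z \<in> open_tile c \<Longrightarrow> z \<in> region A \<longleftrightarrow> c \<in> A"
  unfolding region_def using tile_inter_open_tile[of z c] open_tile_subset_tile[of c] by blast

lemma closed_region: "finite A \<Longrightarrow> closed (region A)"
  by (auto simp: region_def tile_def)

text \<open>For edge neighbours this is the interior of the union of the two tiles. It contains the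
  open common edge, which the two open tiles lack.\<close>

definition domino :: "int \<times> int \<Rightarrow> int \<times> int \<Rightarrow> (real \<times> real) set" where
  "domino c d = box (of_int (min (fst c) (fst d)), of_int (min (snd c) (snd d)))
                    (of_int (max (fst c) (fst d)) + 1, of_int (max (snd c) (snd d)) + 1)"

lemma mem_domino:
  "z \<in> domino c d \<longleftrightarrow> of_int (min (fst c) (fst d)) < fst z \<and> fst z < of_int (max (fst c) (fst d)) + 1 \<and>
     of_int (min (snd c) (snd d)) < snd z \<and> snd z < of_int (max (snd c) (snd d)) + 1"
  by (cases z) (auto simp: domino_def mem_box Basis_prod_def)

lemma connected_domino: "connected (domino c d)"
  by (simp add: domino_def convex_connected)

lemma open_tile_subset_domino: "open_tile c \<subseteq> domino c d" "open_tile d \<subseteq> domino c d"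
  by (auto simp: mem_domino mem_open_tile)

lemma tile_inter_domino:
  assumes "z \<in> domino c d" "z \<in> tile e" "adj c d"
  shows "e = c \<or> e = d"
proof -
  have "fst e < max (fst c) (fst d) + 1" "min (fst c) (fst d) < fst e + 1"
    "snd e < max (snd c) (snd d) + 1" "min (snd c) (snd d) < snd e + 1"
    using assms(1,2) unfolding mem_domino mem_tile by linarith+
  then show ?thesis using assms(3) unfolding adj_def prod_eq_iff by linarith
qed

lemma domino_region_iff:
  assumes "adj c d" "z \<in> domino c d"
  shows "c \<in> A \<Longrightarrow> d \<in> A \<Longrightarrow> z \<in> region A" "c \<notin> A \<Longrightarrow> d \<notin> A \<Longrightarrow> z \<notin> region A"
proof -
  show "z \<in> region A" if "c \<in> A" "d \<in> A"
    using tile_inter_domino[OF assms(2) mem_tile_floor assms(1)] mem_tile_floor[of z] that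
    unfolding region_def by auto
  show "z \<notin> region A" if "c \<notin> A" "d \<notin> A"
    using tile_inter_domino[OF assms(2) _ assms(1)] that unfolding region_def by auto
qed

text \<open>If \<open>X\<close> is a proper part closed under adjacency, the closed regions of
  \<open>X\<close> and \<open>A - X\<close> meet at most in corners of diagonal tiles. Such corners
  are not interior points, so the two regions would disconnect the interior.\<close>

lemma polyomino_imp_edge_connected:
  assumes "polyomino A"
  shows "edge_connected A"
  unfolding edge_connected_def
proof (intro conjI allI impI)
  show "A \<noteq> {}" using assms by (simp add: polyomino_def)
  fix X assume X: "X \<subseteq> A \<and> X \<noteq> {} \<and> (\<forall>a\<in>X. \<forall>b\<in>A. adj a b \<longrightarrow> b \<in> X)"
  let ?I = "interior (region A)"
  have fin: "finite X" "finite (A - X)" and con: "connected ?I"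
    using assms X by (auto simp: polyomino_def intro: finite_subset)
  have cl: "b \<in> X" if "a \<in> X" "b \<in> A" "adj a b" for a b using X that by blast
  have cl': "b \<in> A - X" if "a \<in> A - X" "b \<in> A" "adj a b" for a b using cl that adj_sym by blast
  have sub: "open_tile a \<subseteq> ?I" if "a \<in> A" for a
    using that open_tile_region_iff by (intro interior_maximal open_open_tile) blast
  show "X = A"
  proof (rule ccontr)
    assume "X \<noteq> A"
    then obtain x y where x: "x \<in> X" and y: "y \<in> A - X" using X by blast
    have "region X \<inter> region (A - X) \<inter> ?I = {}"
    proof (rule ccontr)
      assume "\<not> ?thesis"
      then obtain z where "z \<in> ?I" "z \<in> region X" "z \<in> region (A - X)" by blast
      then obtain a b where z: "z \<in> ?I" "z \<in> tile a" "z \<in> tile b" and ab: "a \<in> X" "b \<in> A - X"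
        unfolding region_def by blast
      have "a \<noteq> b" "\<not> adj a b" using ab cl by blast+
      moreover have "\<bar>fst a - fst b\<bar> \<le> 1" "\<bar>snd a - snd b\<bar> \<le> 1"
        using z(2,3) unfolding mem_tile by linarith+
      ultimately have dg: "\<bar>fst a - fst b\<bar> = 1" "\<bar>snd a - snd b\<bar> = 1"
        unfolding adj_def prod_eq_iff by linarith+
      \<comment> \<open>A cell adjacent to both \<open>a\<close> and \<open>b\<close>. As a tile it
        would lie in \<open>X\<close> and in \<open>A - X\<close>, so it is missing, yet
        \<open>z\<close> lies in its closed tile.\<close>
      let ?c = "(fst a, snd b)"
      have "adj a ?c" "adj b ?c" using dg by (auto simp: adj_def)
      then have c: "?c \<notin> A" using cl[OF ab(1)] cl'[OF ab(2)] by blast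
      have "z \<in> closure (open_tile ?c)" using z unfolding tile_eq_closure[symmetric] mem_tile by simp
      then have "?I \<inter> open_tile ?c \<noteq> {}"
        using z(1) open_Int_closure_eq_empty[of ?I "open_tile ?c"] by auto
      then show False using open_tile_region_iff c interior_subset by blast
    qed
    moreover have "?I \<subseteq> region X \<union> region (A - X)"
    proof -
      have "region A = region X \<union> region (A - X)" using X unfolding region_def by blast
      then show ?thesis using interior_subset[of "region A"] by blast
    qed
    moreover have "region X \<inter> ?I \<noteq> {}" "region (A - X) \<inter> ?I \<noteq> {}"
    proof -
      have ex: "\<exists>w. w \<in> tile c \<inter> ?I" if "c \<in> A" for c
        using center_in_open_tile[of c] sub[OF that] open_tile_subset_tile[of c] by blast
      have "x \<in> A" "y \<in> A" using x y X by auto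
      then obtain v w where "v \<in> tile x \<inter> ?I" "w \<in> tile y \<inter> ?I" using ex by meson
      moreover have "tile x \<subseteq> region X" "tile y \<subseteq> region (A - X)"
        using x y unfolding region_def by blast+
      ultimately show "region X \<inter> ?I \<noteq> {}" "region (A - X) \<inter> ?I \<noteq> {}" by blast+
    qed
    ultimately show False
      using connected_closedD[OF con _ _ closed_region[OF fin(1)] closed_region[OF fin(2)]] by blast
  qed
qed

text \<open>The union \<open>U\<close> of open tiles and dominoes is connected and lies between the
  interior and a dense part of it: the interior is contained in the closure of \<open>U\<close>. So
  the interior need not be computed exactly.\<close>

lemma edge_connected_imp_polyomino:
  assumes fin: "finite A" and con: "edge_connected A"
  shows "polyomino A"
proof -
  define U where "U = (\<Union>a\<in>A. open_tile a) \<union> (\<Union>a\<in>A. \<Union>b\<in>{b\<in>A. adj a b}. domino a b)"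
  have openU: "open U" unfolding U_def domino_def by (intro open_Un open_UN ballI open_open_tile open_box)
  have UI: "U \<subseteq> interior (region A)"
    using openU open_tile_region_iff domino_region_iff(1) by (intro interior_maximal) (auto simp: U_def)
  have "interior (region A) \<subseteq> region A" by (rule interior_subset)
  also have "\<dots> \<subseteq> closure U"
    unfolding region_def tile_eq_closure by (intro UN_least closure_mono) (auto simp: U_def)
  finally have IU: "interior (region A) \<subseteq> closure U" .
  obtain c where c: "c \<in> A" using con unfolding edge_connected_def by blast
  define w where "w = (real_of_int (fst c) + 1/2, real_of_int (snd c) + 1/2)"
  define K where "K = connected_component_set U w"
  have w: "w \<in> open_tile c" unfolding w_def by (rule center_in_open_tile)
  have tileU: "open_tile a \<subseteq> U" if "a \<in> A" for a using that unfolding U_def by blast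
  have grow: "T \<subseteq> K" if "connected T" "T \<subseteq> U" "T \<inter> K \<noteq> {}" for T
    using that connected_component_maximal connected_component_eq unfolding K_def by blast
  have "{a \<in> A. open_tile a \<subseteq> K} = A" (is "?X = A")
  proof (rule edge_connectedD[OF con])
    have "w \<in> K" using w tileU[OF c] unfolding K_def by (auto simp: connected_component_refl)
    then have "open_tile c \<subseteq> K" using grow[OF connected_open_tile tileU[OF c]] w by blast
    then show "?X \<noteq> {}" using c by blast
  next
    fix a b assume *: "a \<in> ?X" "b \<in> A" "adj a b"
    have "domino a b \<inter> K \<noteq> {}"
      using * open_tile_subset_domino(1)[of a b] center_in_open_tile[of a] by blast
    moreover have "domino a b \<subseteq> U" using * unfolding U_def by blast
    ultimately have "domino a b \<subseteq> K" using grow connected_domino by blast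
    then show "b \<in> ?X" using * open_tile_subset_domino(2) by blast
  qed auto
  then have X: "open_tile a \<subseteq> K" if "a \<in> A" for a using that by blast
  have "domino a b \<subseteq> K" if "a \<in> A" "b \<in> A" "adj a b" for a b
  proof (rule grow[OF connected_domino])
    show "domino a b \<subseteq> U" using that unfolding U_def by blast
    show "domino a b \<inter> K \<noteq> {}"
      using X[OF that(1)] open_tile_subset_domino(1)[of a b] center_in_open_tile[of a] by blast
  qed
  then have "U \<subseteq> K" using X unfolding U_def by blast
  moreover have "K \<subseteq> U" unfolding K_def by (rule connected_component_subset)
  moreover have "connected K" unfolding K_def by (rule connected_connected_component)
  ultimately have "connected U" by simp
  then have "connected (interior (region A))" using UI IU by (rule connected_intermediate_closure)
  then show ?thesis using fin c unfolding polyomino_def by blast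
qed

section \<open>Components of the complement as sets of cells\<close>

lemma open_tile_in_component:
  assumes "C \<in> components (- region A)" "w \<in> open_tile d" "w \<in> C"
  shows "d \<notin> A" "open_tile d \<subseteq> C"
proof -
  have "w \<notin> region A" using assms in_components_subset by blast
  then show d: "d \<notin> A" using open_tile_region_iff assms(2) by blast
  show "open_tile d \<subseteq> C"
    using assms d open_tile_region_iff
    by (intro components_maximal[OF assms(1) connected_open_tile]) blast+
qed

definition inner_cells :: "(real \<times> real) set \<Rightarrow> (int \<times> int) set" where
  "inner_cells C = {c. open_tile c \<subseteq> C}"

text \<open>Components are open, so they meet the open tile of any closed tile they touch; dominoes
  outside the region carry a component across edges. These facts supply the conditions of
  \<open>hole_family\<close>.\<close>

lemma inner_cells_component:
  assumes fin: "finite A" and C: "C \<in> components (- region A)"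
  shows "inner_cells C \<noteq> {}" "inner_cells C \<inter> A = {}"
    "a \<in> inner_cells C \<Longrightarrow> adj a b \<Longrightarrow> b \<in> inner_cells C \<union> A"
    "bounded C \<Longrightarrow> finite (inner_cells C)"
proof -
  have opn: "open C" using open_components[OF _ C] closed_region[OF fin] by (simp add: open_closed)
  obtain z where z: "z \<in> C" using in_components_nonempty[OF C] by blast
  let ?d = "(\<lfloor>fst z\<rfloor>, \<lfloor>snd z\<rfloor>)"
  have "z \<in> closure (open_tile ?d)" using mem_tile_floor[of z] by (simp add: tile_eq_closure)
  then have "C \<inter> open_tile ?d \<noteq> {}" using z open_Int_closure_eq_empty[OF opn, of "open_tile ?d"] by auto
  then have "?d \<in> inner_cells C" using open_tile_in_component[OF C] unfolding inner_cells_def by blast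
  then show "inner_cells C \<noteq> {}" by blast
  have ctr: "(of_int (fst c) + 1/2, of_int (snd c) + 1/2) \<in> C" if "c \<in> inner_cells C" for c
    using that center_in_open_tile unfolding inner_cells_def by blast
  then show disj: "inner_cells C \<inter> A = {}"
    using open_tile_in_component(1)[OF C center_in_open_tile] by blast
  show "b \<in> inner_cells C \<union> A" if ab: "a \<in> inner_cells C" "adj a b"
  proof (cases "b \<in> A")
    case False
    have "a \<notin> A" using ab disj by blast
    then have "domino a b \<subseteq> - region A" using domino_region_iff(2)[OF ab(2)] False by blast
    moreover have "C \<inter> domino a b \<noteq> {}"
      using ctr[OF ab(1)] center_in_open_tile[of a] open_tile_subset_domino(1)[of a b] by blast
    ultimately have "domino a b \<subseteq> C" using components_maximal[OF C connected_domino] by blast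
    then show ?thesis using open_tile_subset_domino(2) unfolding inner_cells_def by blast
  qed simp
  show "finite (inner_cells C)" if "bounded C"
  proof -
    obtain B where B: "\<And>z. z \<in> C \<Longrightarrow> norm z \<le> B" using \<open>bounded C\<close> unfolding bounded_iff by blast
    have "inner_cells C \<subseteq> {- \<lceil>B\<rceil> - 1..\<lceil>B\<rceil> + 1} \<times> {- \<lceil>B\<rceil> - 1..\<lceil>B\<rceil> + 1}"
    proof
      fix c assume "c \<in> inner_cells C"
      note * = B[OF ctr[OF this]]
      have "\<bar>real_of_int (fst c) + 1/2\<bar> \<le> B" "\<bar>real_of_int (snd c) + 1/2\<bar> \<le> B"
        using order_trans[OF norm_fst_le *] order_trans[OF norm_snd_le *] by simp_all
      then show "c \<in> {- \<lceil>B\<rceil> - 1..\<lceil>B\<rceil> + 1} \<times> {- \<lceil>B\<rceil> - 1..\<lceil>B\<rceil> + 1}"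
        by (simp add: mem_Times_iff) linarith
    qed
    then show ?thesis by (rule finite_subset) simp
  qed
qed

lemma inner_cells_disjoint:
  assumes "C \<in> components S" "D \<in> components S" "inner_cells C \<inter> inner_cells D \<noteq> {}"
  shows "C = D"
proof -
  obtain c where "open_tile c \<subseteq> C" "open_tile c \<subseteq> D" using assms(3) unfolding inner_cells_def by blast
  then have "C \<inter> D \<noteq> {}" using center_in_open_tile by blast
  then show ?thesis using assms(1,2) components_eq by blast
qed

lemma hole_family_components:
  assumes fin: "finite A" and "holes A \<ge> 1"
  shows "hole_family A {C \<in> components (- region A). bounded C} inner_cells"
proof -
  \<comment> \<open>An infinite set has \<open>card\<close> equal to 0, so a positive value of
    \<open>holes A\<close> forces finiteness.\<close>
  have "finite {C \<in> components (- region A). bounded C}"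
    using assms(2) unfolding holes_def by (metis card.infinite not_one_le_zero)
  moreover have "disjoint_family_on inner_cells {C \<in> components (- region A). bounded C}"
    unfolding disjoint_family_on_def using inner_cells_disjoint by blast
  ultimately show ?thesis
    unfolding hole_family_def using inner_cells_component[OF fin] by simp
qed

text \<open>The sides of the tile are covered by the four neighbouring tiles, so a component of the
  complement is split by the open sets \<open>open_tile s\<close> and \<open>- tile s\<close> and
  stays in the first.\<close>

lemma open_tile_component:
  assumes "s \<notin> A" "\<And>q. adj s q \<Longrightarrow> q \<in> A"
  shows "open_tile s \<in> components (- region A)"
proof -
  have sub: "open_tile s \<subseteq> - region A" using open_tile_region_iff assms(1) by blast
  then have "(of_int (fst s) + 1/2, of_int (snd s) + 1/2) \<in> - region A" using center_in_open_tile by blast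
  then obtain C where C: "C \<in> components (- region A)" "(of_int (fst s) + 1/2, of_int (snd s) + 1/2) \<in> C"
    by (metis UnionE Union_components)
  have "open_tile s \<subseteq> C" using open_tile_in_component(2)[OF C(1) center_in_open_tile C(2)] .
  moreover have "C \<subseteq> open_tile s"
  proof (rule ccontr)
    assume "\<not> ?thesis"
    have "C \<subseteq> open_tile s \<union> - tile s"
    proof
      fix z assume z: "z \<in> C"
      show "z \<in> open_tile s \<union> - tile s"
      proof (rule ccontr)
        assume "\<not> ?thesis"
        then have zs: "z \<in> tile s" "z \<notin> open_tile s" by auto
        obtain x y where s: "s = (x, y)" by (cases s)
        have "\<exists>q. adj s q \<and> z \<in> tile q"
        proof -
          consider "fst z = of_int x" | "fst z = of_int x + 1" | "snd z = of_int y" | "snd z = of_int y + 1"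
            using zs unfolding mem_tile mem_open_tile s by force
          then show ?thesis
          proof cases
            case 1 then show ?thesis using zs by (intro exI[of _ "(x - 1, y)"]) (auto simp: s adj_def mem_tile)
          next
            case 2 then show ?thesis using zs by (intro exI[of _ "(x + 1, y)"]) (auto simp: s adj_def mem_tile)
          next
            case 3 then show ?thesis using zs by (intro exI[of _ "(x, y - 1)"]) (auto simp: s adj_def mem_tile)
          next
            case 4 then show ?thesis using zs by (intro exI[of _ "(x, y + 1)"]) (auto simp: s adj_def mem_tile)
          qed
        qed
        then have "z \<in> region A" using assms(2) unfolding region_def by blast
        then show False using z C(1) in_components_subset by blast
      qed
    qed
    moreover have "open (- tile s)" unfolding tile_def by (rule open_Compl[OF closed_cbox])
    moreover have "connected C" using C(1) in_components_connected by blast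
    moreover have "open_tile s \<inter> - tile s \<inter> C = {}" using open_tile_subset_tile by blast
    ultimately have "open_tile s \<inter> C = {} \<or> - tile s \<inter> C = {}"
      using open_open_tile[of s] by (intro connectedD)
    then show False using C(2) center_in_open_tile[of s] \<open>C \<subseteq> open_tile s \<union> - tile s\<close> \<open>\<not> C \<subseteq> open_tile s\<close> by blast
  qed
  ultimately show ?thesis using C(1) by simp
qed

text \<open>\<open>S\<close> collects single-cell holes. The inner cells of any bounded component
  form a set \<open>D\<close> as in \<open>out\<close>, so they meet \<open>S\<close>, and the
  component is one of these holes.\<close>

lemma holes_eq_card:
  assumes fin: "finite A" and S: "S \<inter> A = {}" "\<And>s q. s \<in> S \<Longrightarrow> adj s q \<Longrightarrow> q \<in> A"
    and out: "\<And>D. finite D \<Longrightarrow> D \<noteq> {} \<Longrightarrow> D \<inter> A = {} \<Longrightarrow>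
      (\<And>a b. a \<in> D \<Longrightarrow> adj a b \<Longrightarrow> b \<in> D \<union> A) \<Longrightarrow> D \<inter> S \<noteq> {}"
  shows "holes A = card S"
proof -
  have comp: "open_tile s \<in> components (- region A)" if "s \<in> S" for s
    using open_tile_component[of s A] S that by blast
  have "bounded (open_tile s)" for s
    using bounded_subset[OF _ open_tile_subset_tile] by (simp add: tile_def)
  then have "open_tile ` S \<subseteq> {C \<in> components (- region A). bounded C}" using comp by blast
  moreover have "C \<in> open_tile ` S" if C: "C \<in> components (- region A)" "bounded C" for C
  proof -
    have "inner_cells C \<inter> S \<noteq> {}" using inner_cells_component[OF fin C(1)] C(2) by (intro out) blast+
    then obtain s where s: "s \<in> S" "open_tile s \<subseteq> C" unfolding inner_cells_def by blast
    then have "C \<inter> open_tile s \<noteq> {}" using center_in_open_tile by blast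
    then have "C = open_tile s" using C(1) comp[OF s(1)] components_eq by blast
    then show ?thesis using s by blast
  qed
  ultimately have "{C \<in> components (- region A). bounded C} = open_tile ` S" by blast
  moreover have "inj_on open_tile S"
    using center_in_open_tile open_tile_subset_tile tile_inter_open_tile by (intro inj_onI) blast
  ultimately show ?thesis by (simp add: holes_def card_image)
qed

subsection \<open>Extremal polyominoes\<close>

text \<open>Connectedness leaves at most \<open>card A + 1\<close> upper and right boundary edges.
  The filled set needs one per column and one per row, and each hole needs one of either kind. In
  the case of equality every estimate is sharp, and a hole with one upper and one right edge has one
  column and one row.\<close>

lemma hole_family_filled_bound:
  assumes fin: "finite A" and con: "edge_connected A" and hf: "hole_family A I C"
  defines "F \<equiv> A \<union> (\<Union>i\<in>I. C i)"
  shows "card (fst ` F) + card (snd ` F) + 2 * card I \<le> card A + 1"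
    and "card A + card I \<le> card F"
    and "card A + 1 \<le> card (fst ` F) + card (snd ` F) + 2 * card I \<Longrightarrow>
      card (adj_pairs A) + 2 = 2 * card A \<and> per (0, 1) F = card (fst ` F) \<and>
      per (1, 0) F = card (snd ` F) \<and> (\<forall>i\<in>I. is_singleton (C i)) \<and> card F = card A + card I"
proof -
  have finI: "finite I" and disj: "disjoint_family_on C I"
    and finC: "\<And>i. i \<in> I \<Longrightarrow> finite (C i)" and ne: "\<And>i. i \<in> I \<Longrightarrow> C i \<noteq> {}"
    and CA: "\<And>i. i \<in> I \<Longrightarrow> C i \<inter> A = {}"
    using hf unfolding hole_family_def by blast+
  have finF: "finite F" using fin finI finC by (simp add: F_def)
  have "card F = card A + card (\<Union>i\<in>I. C i)"
    unfolding F_def using fin finI finC CA by (intro card_Un_disjoint) auto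
  also have "card (\<Union>i\<in>I. C i) = (\<Sum>i\<in>I. card (C i))"
    using finI finC disj unfolding disjoint_family_on_def by (intro card_UN_disjoint) auto
  finally have cF: "card F = card A + (\<Sum>i\<in>I. card (C i))" .
  have pos: "card (C i) \<ge> 1" "card (fst ` C i) \<ge> 1" "card (snd ` C i) \<ge> 1" if "i \<in> I" for i
    using finC[OF that] ne[OF that] by (simp_all add: Suc_le_eq card_gt_0_iff)
  have "(\<Sum>i\<in>I. 1) \<le> (\<Sum>i\<in>I. card (C i))" using pos by (intro sum_mono)
  then show "card A + card I \<le> card F" using cF by simp
  have pU: "per (0,1) A = per (0,1) F + (\<Sum>i\<in>I. per (0,1) (C i))"
    and pR: "per (1,0) A = per (1,0) F + (\<Sum>i\<in>I. per (1,0) (C i))"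
    unfolding F_def by (rule per_filled[OF fin hf]; simp add: adj_def)+
  have geU: "1 \<le> per (0,1) (C i)" and geR: "1 \<le> per (1,0) (C i)" if "i \<in> I" for i
    using card_fst_le_per(1)[OF finC[OF that]] card_snd_le_per(1)[OF finC[OF that]] pos[OF that] by linarith+
  have sU: "(\<Sum>i\<in>I. 1) \<le> (\<Sum>i\<in>I. per (0,1) (C i))" and sR: "(\<Sum>i\<in>I. 1) \<le> (\<Sum>i\<in>I. per (1,0) (C i))"
    using geU geR by (intro sum_mono; simp)+
  have tree: "card (adj_pairs A) + 2 \<ge> 2 * card A"
    using edge_connected_tree_potential[OF fin con, of "\<lambda>_ _. 0"] by simp
  note F = card_fst_le_per(1)[OF finF] card_snd_le_per(1)[OF finF]
  note tot = card_adj_pairs_per[OF fin]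
  show "card (fst ` F) + card (snd ` F) + 2 * card I \<le> card A + 1"
    using pU pR sU sR tree F tot by simp
  assume eq: "card A + 1 \<le> card (fst ` F) + card (snd ` F) + 2 * card I"
  have e: "card (adj_pairs A) + 2 = 2 * card A" "per (0, 1) F = card (fst ` F)" "per (1, 0) F = card (snd ` F)"
    "(\<Sum>i\<in>I. per (0,1) (C i)) = (\<Sum>i\<in>I. 1)" "(\<Sum>i\<in>I. per (1,0) (C i)) = (\<Sum>i\<in>I. 1)"
    using pU pR sU sR tree F tot eq by simp_all
  have single: "is_singleton (C i)" if i: "i \<in> I" for i
  proof -
    have "per (0,1) (C i) = 1" "per (1,0) (C i) = 1"
      using sum_mono_inv[OF e(4)[symmetric] _ i finI] sum_mono_inv[OF e(5)[symmetric] _ i finI] geU geR by simp_all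
    then have le: "card (fst ` C i) \<le> 1" "card (snd ` C i) \<le> 1"
      using card_fst_le_per(1)[OF finC[OF i]] card_snd_le_per(1)[OF finC[OF i]] by linarith+
    have "\<forall>x\<in>fst ` C i. \<forall>y\<in>fst ` C i. x = y" "\<forall>x\<in>snd ` C i. \<forall>y\<in>snd ` C i. x = y"
      using le unfolding One_nat_def card_le_Suc0_iff_eq[OF finite_imageI[OF finC[OF i]]] by blast+
    then have "c = d" if "c \<in> C i" "d \<in> C i" for c d
      using that by (intro prod_eqI) blast+
    then show ?thesis using ne[OF i] by (intro is_singletonI')
  qed
  then have "(\<Sum>i\<in>I. card (C i)) = (\<Sum>i\<in>I. 1)" by (intro sum.cong) (auto simp: is_singleton_altdef)
  then show "card (adj_pairs A) + 2 = 2 * card A \<and> per (0, 1) F = card (fst ` F) \<and>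
      per (1, 0) F = card (snd ` F) \<and> (\<forall>i\<in>I. is_singleton (C i)) \<and> card F = card A + card I"
    using e single cF by simp
qed

text \<open>Let \<open>e\<close> be the deficit of \<open>c + r\<close> from \<open>2 * m\<close>.
  The perimeter bound gives \<open>n + h \<ge> m\<^sup>2 - 1 - e\<close>, while a deficit lowers the
  maximal area \<open>c * r\<close> by about \<open>e * m\<close>. This forces \<open>e = 0\<close>
  and then \<open>\<bar>c - r\<bar> \<le> 2\<close>.\<close>

lemma near_square_numbers:
  fixes c r n h m :: nat
  assumes m: "m \<ge> 3" and h: "3 * h + 1 = (m - 1)\<^sup>2"
    and per: "c + r + 2 * h \<le> n + 1" and area: "n + h \<le> c * r" and n: "n + h + 1 \<le> m\<^sup>2"
  shows "n + h + 1 = m\<^sup>2" "n + 1 = c + r + 2 * h"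
    "c = m \<and> r = m \<or> c * r = n + h"
proof -
  define C R N H M where d: "C = int c" "R = int r" "N = int n" "H = int h" "M = int m"
  have M: "M \<ge> 3" using m by (simp add: d)
  have "int (m - 1) = M - 1" using m by (simp add: d)
  then have h': "3 * H + 1 = (M - 1)\<^sup>2" using arg_cong[OF h, of int] by (simp add: d)
  have per': "C + R + 2 * H \<le> N + 1" using per by (simp add: d)
  have area': "N + H \<le> C * R" using area by (simp add: d flip: of_nat_mult of_nat_add)
  have n': "N + H + 1 \<le> M\<^sup>2" using n by (simp add: d flip: of_nat_power)
  define e where "e = 2 * M - (C + R)"
  have sq: "(M - 1)\<^sup>2 = M\<^sup>2 - 2 * M + 1" by (simp add: power2_eq_square algebra_simps)
  have e: "M\<^sup>2 - 1 - (N + H) \<le> e" using per' h' sq by (simp add: e_def)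
  have e0: "e \<ge> 0" using e n' by simp
  have e2: "e \<le> 2 * M" by (simp add: e_def d)
  have amgm: "4 * (C * R) = (C + R)\<^sup>2 - (C - R)\<^sup>2" by (simp add: power2_eq_square algebra_simps)
  have CR: "(C + R)\<^sup>2 = 4 * M\<^sup>2 - e * (4 * M - e)" by (simp add: e_def power2_eq_square algebra_simps)
  have "M\<^sup>2 - 1 - e \<le> C * R" using area' e by linarith
  then have "4 * (M\<^sup>2 - 1 - e) \<le> (C + R)\<^sup>2 - (C - R)\<^sup>2" unfolding amgm[symmetric] by simp
  then have *: "e * (4 * M - 4 - e) + (C - R)\<^sup>2 \<le> 4" using CR by (simp add: algebra_simps)
  then have **: "e * (4 * M - 4 - e) \<le> 4" using zero_le_power2[of "C - R"] by linarith
  have "e = 0"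
  proof (rule ccontr)
    assume "e \<noteq> 0"
    then consider "e = 1" | "e = 2" | "e \<ge> 3" using e0 by linarith
    then show False
    proof cases
      case 3
      then have "3 * 2 \<le> e * (4 * M - 4 - e)" using e2 M by (intro mult_mono) auto
      then show ?thesis using ** by simp
    qed (use ** M in auto)
  qed
  then have NH: "N + H + 1 = M\<^sup>2" and sum: "C + R = 2 * M" using e n' e_def by auto
  then show "n + h + 1 = m\<^sup>2" by (simp add: d flip: of_nat_power)
  have "N + 1 = C + R + 2 * H" using NH sum h' sq by linarith
  then show "n + 1 = c + r + 2 * h" by (simp add: d)
  have "(C - R)\<^sup>2 \<le> 4" using * \<open>e = 0\<close> by simp
  then have "\<bar>C - R\<bar> \<le> 2" using abs_le_square_iff[of "C - R" 2] by simp
  then have "C = M \<or> C = M + 1 \<or> C = M - 1" using sum by linarith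
  then show "c = m \<and> r = m \<or> c * r = n + h"
  proof (elim disjE)
    assume "C = M"
    then show ?thesis using sum by (simp add: d)
  next
    assume c: "C = M + 1"
    then have r: "R = M - 1" using sum by simp
    have "C * R = M\<^sup>2 - 1" unfolding c r by (simp add: power2_eq_square algebra_simps)
    then have "C * R = N + H" using NH by simp
    then show ?thesis by (simp add: d flip: of_nat_mult of_nat_add)
  next
    assume c: "C = M - 1"
    then have r: "R = M + 1" using sum by simp
    have "C * R = M\<^sup>2 - 1" unfolding c r by (simp add: power2_eq_square algebra_simps)
    then have "C * R = N + H" using NH by simp
    then show ?thesis by (simp add: d flip: of_nat_mult of_nat_add)
  qed
qed

section \<open>The shape of the filled set\<close>

lemma convex_int_set:
  fixes X :: "int set"
  assumes "finite X" "card X = Suc k" and "\<And>a b w. a \<in> X \<Longrightarrow> b \<in> X \<Longrightarrow> a \<le> w \<Longrightarrow> w \<le> b \<Longrightarrow> w \<in> X"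
  shows "\<exists>a. X = {a..a + int k}"
proof -
  have ne: "X \<noteq> {}" using assms(2) by auto
  have X: "X = {Min X..Max X}"
  proof
    show "X \<subseteq> {Min X..Max X}" using assms(1) by auto
    show "{Min X..Max X} \<subseteq> X"
      using assms(3)[OF Min_in[OF assms(1) ne] Max_in[OF assms(1) ne]] by auto
  qed
  have "Min X \<le> Max X" using assms(1) ne by simp
  moreover have "card X = nat (Max X - Min X + 1)" by (subst X) simp
  ultimately have "Max X = Min X + int k" using assms(2) by simp
  then show ?thesis using X by metis
qed

text \<open>Counting leaves one missing cell in the product of the projections. A row and a column
  that avoid it, available since \<open>k \<ge> 1\<close>, show that the projections are intervals;
  a missing cell away from a corner would break the convexity of its row or column.\<close>

lemma square_minus_corner:
  fixes F :: "(int \<times> int) set"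
  assumes fin: "finite F" and k: "k \<ge> 1"
    and X: "card (fst ` F) = Suc k" "per (0, 1) F = card (fst ` F)"
    and Y: "card (snd ` F) = Suc k" "per (1, 0) F = card (snd ` F)"
    and cF: "card F + 1 = (Suc k)\<^sup>2"
  obtains a b p q where "F = {a..a + int k} \<times> {b..b + int k} - {(p, q)}"
    "p = a \<or> p = a + int k" "q = b \<or> q = b + int k"
proof -
  have col: "\<And>x y z w. (x, y) \<in> F \<Longrightarrow> (x, z) \<in> F \<Longrightarrow> y \<le> w \<Longrightarrow> w \<le> z \<Longrightarrow> (x, w) \<in> F"
    using card_fst_le_per(2)[OF fin X(2)[symmetric]] by blast
  have row: "\<And>x y z w. (y, x) \<in> F \<Longrightarrow> (z, x) \<in> F \<Longrightarrow> y \<le> w \<Longrightarrow> w \<le> z \<Longrightarrow> (w, x) \<in> F"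
    using card_snd_le_per(2)[OF fin Y(2)[symmetric]] by blast
  let ?X = "fst ` F" and ?Y = "snd ` F"
  have finXY: "finite (?X \<times> ?Y)" using fin by simp
  have sub: "F \<subseteq> ?X \<times> ?Y" by force
  have "card (?X \<times> ?Y - F) = card (?X \<times> ?Y) - card F" using sub fin by (simp add: card_Diff_subset)
  also have "card (?X \<times> ?Y) = (Suc k)\<^sup>2" using X(1) Y(1) by (simp add: card_cartesian_product power2_eq_square)
  finally have "card (?X \<times> ?Y - F) = 1" using cF by simp
  then obtain z where "?X \<times> ?Y - F = {z}" by (auto simp: card_1_singleton_iff)
  then obtain p q where pq: "?X \<times> ?Y - F = {(p, q)}" by (cases z) auto
  have p: "p \<in> ?X" "q \<in> ?Y" using pq by blast+
  have mem: "(x, y) \<in> F" if "x \<in> ?X" "y \<in> ?Y" "(x, y) \<noteq> (p, q)" for x y using that pq by blast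
  have two: "\<exists>y\<in>S. y \<noteq> v" if "card S = Suc k" for S and v :: int
  proof (rule ccontr)
    assume "\<not> ?thesis"
    then have "card S \<le> card {v}" by (intro card_mono) auto
    then show False using that k by simp
  qed
  obtain y where y: "y \<in> ?Y" "y \<noteq> q" using two[OF Y(1)] by blast
  obtain x where x: "x \<in> ?X" "x \<noteq> p" using two[OF X(1)] by blast
  have cX: "w \<in> ?X" if "a \<in> ?X" "b \<in> ?X" "a \<le> w" "w \<le> b" for a b w
    using row[OF mem[OF that(1) y(1)] mem[OF that(2) y(1)] that(3,4)] y(2) by force
  have "\<exists>a. ?X = {a..a + int k}"
    by (rule convex_int_set[OF finite_imageI[OF fin] X(1)]) (rule cX)
  then obtain a where a: "?X = {a..a + int k}" by blast
  have cY: "w \<in> ?Y" if "a \<in> ?Y" "b \<in> ?Y" "a \<le> w" "w \<le> b" for a b w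
    using col[OF mem[OF x(1) that(1)] mem[OF x(1) that(2)] that(3,4)] x(2) by force
  have "\<exists>b. ?Y = {b..b + int k}"
    by (rule convex_int_set[OF finite_imageI[OF fin] Y(1)]) (rule cY)
  then obtain b where b: "?Y = {b..b + int k}" by blast
  have npq: "(p, q) \<notin> F" using pq by blast
  have "p = a \<or> p = a + int k"
  proof (rule ccontr)
    assume "\<not> ?thesis"
    then have "p - 1 \<in> ?X" "p + 1 \<in> ?X" using p(1) unfolding a by auto
    then have "(p - 1, q) \<in> F" "(p + 1, q) \<in> F" using mem p(2) by auto
    then show False using row[of "p - 1" q "p + 1" p] npq by simp
  qed
  moreover have "q = b \<or> q = b + int k"
  proof (rule ccontr)
    assume "\<not> ?thesis"
    then have "q - 1 \<in> ?Y" "q + 1 \<in> ?Y" using p(2) unfolding b by auto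
    then have "(p, q - 1) \<in> F" "(p, q + 1) \<in> F" using mem p(1) by auto
    then show False using col[of p "q - 1" "q + 1" q] npq by simp
  qed
  moreover have "F = ?X \<times> ?Y - {(p, q)}" using pq sub by blast
  ultimately show ?thesis using that a b by metis
qed

section \<open>Moving the missing corner to the origin by a translation and reflections\<close>

definition flip :: "int \<Rightarrow> int \<Rightarrow> int \<times> int \<Rightarrow> int \<times> int \<Rightarrow> int \<times> int" where
  "flip s u c p = (s * (fst p - fst c), u * (snd p - snd c))"

lemma flip_unflip:
  assumes "\<bar>s\<bar> = 1" "\<bar>u\<bar> = 1"
  shows "(s * fst (flip s u c p) + fst c, u * snd (flip s u c p) + snd c) = p"
proof -
  have "s * s = 1" "u * u = 1" using assms by (auto simp: abs_if split: if_splits)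
  then show ?thesis by (simp add: flip_def prod_eq_iff flip: mult.assoc)
qed

lemma flip_onto:
  assumes "\<bar>s\<bar> = 1" "\<bar>u\<bar> = 1"
  shows "flip s u c (s * fst z + fst c, u * snd z + snd c) = z"
proof -
  have "s * s = 1" "u * u = 1" using assms by (auto simp: abs_if split: if_splits)
  then show ?thesis by (simp add: flip_def prod_eq_iff flip: mult.assoc)
qed

lemma inj_flip: "\<bar>s\<bar> = 1 \<Longrightarrow> \<bar>u\<bar> = 1 \<Longrightarrow> inj (flip s u c)"
  by (metis flip_unflip injI)

lemma adj_flip: "\<bar>s\<bar> = 1 \<Longrightarrow> \<bar>u\<bar> = 1 \<Longrightarrow> adj (flip s u c p) (flip s u c q) \<longleftrightarrow> adj p q"
  unfolding adj_def flip_def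
  by (simp add: abs_mult flip: right_diff_distrib)

lemma edge_connected_image:
  assumes con: "edge_connected A" and adj: "\<And>a b. adj (f a) (f b) \<longleftrightarrow> adj a b"
  shows "edge_connected (f ` A)"
  unfolding edge_connected_def
proof (intro conjI allI impI)
  show "f ` A \<noteq> {}" using con unfolding edge_connected_def by blast
  fix X assume X: "X \<subseteq> f ` A \<and> X \<noteq> {} \<and> (\<forall>a\<in>X. \<forall>b\<in>f ` A. adj a b \<longrightarrow> b \<in> X)"
  have "{a \<in> A. f a \<in> X} = A"
    by (rule edge_connectedD[OF con]) (use X adj in blast)+
  then show "X = f ` A" using X by blast
qed

text \<open>Symmetries change the form \<open>2 x dy\<close>, so its potential is not transported;
  instead the tree supplies a potential for the pulled-back form \<open>?w\<close>.\<close>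

lemma area_potential_image:
  assumes fin: "finite A" and con: "edge_connected A" and tree: "card (adj_pairs A) + 2 = 2 * card A"
    and f: "inj f" "\<And>a b. adj (f a) (f b) \<longleftrightarrow> adj a b"
  shows "area_potential (f ` A)"
proof -
  let ?w = "\<lambda>a b. real_of_int ((fst (f a) + fst (f b)) * (snd (f b) - snd (f a)))"
  have "has_potential ?w A"
    using edge_connected_tree_potential[OF fin con, of ?w] tree by (simp add: algebra_simps)
  then obtain \<phi> where \<phi>: "\<And>a b. a \<in> A \<Longrightarrow> b \<in> A \<Longrightarrow> adj a b \<Longrightarrow> \<phi> b - \<phi> a = ?w a b"
    unfolding has_potential_def by blast
  show ?thesis
    unfolding area_potential_def
    by (intro exI[of _ "\<lambda>a. \<phi> (inv f a)"] ballI impI) (use \<phi> f in auto)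
qed

lemma free_equiv_flip:
  assumes "\<bar>s\<bar> = 1" "\<bar>u\<bar> = 1"
  shows "free_equiv (flip s u c ` B) B"
proof -
  let ?\<sigma> = "\<lambda>(x, y). (s * x, u * y)"
  have "s = 1 \<or> s = -1" "u = 1 \<or> u = -1" using assms by auto
  then have "?\<sigma> \<in> lattice_symmetries" by (elim disjE) (simp_all add: lattice_symmetries_def)
  moreover have "B = (\<lambda>p. ?\<sigma> p + c) ` flip s u c ` B"
  proof -
    have "?\<sigma> (flip s u c p) + c = p" for p
      using flip_unflip[OF assms, of c p] by (simp add: case_prod_beta prod_eq_iff)
    then show ?thesis by (simp add: image_image)
  qed
  ultimately show ?thesis unfolding free_equiv_def by blast
qed

section \<open>Counts for the extremal shape and comparison with other polyominoes\<close>

lemma card_frame_hole_pattern: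
  "card (frame (2 ^ l) (hole_pattern l)) + card (hole_pattern l) + 1 = (2 ^ l + 1)\<^sup>2"
proof -
  let ?M = "2 ^ l :: int" and ?H = "hole_pattern l"
  have H: "?H \<subseteq> {1..?M - 1} \<times> {1..?M - 1}" using separated_hole_pattern unfolding separated_def by blast
  have "{0..?M} \<times> {0..?M} = frame ?M ?H \<union> insert (0, 0) ?H" using H by (auto simp: frame_def)
  also have "card \<dots> = card (frame ?M ?H) + card (insert (0, 0) ?H)"
    by (rule card_Un_disjoint) (auto simp: frame_def finite_hole_pattern)
  also have "card (insert (0, 0) ?H) = card ?H + 1"
    using H finite_hole_pattern by (subst card_insert_disjoint) auto
  finally have "card (frame ?M ?H) + card ?H + 1 = card ({0..?M} \<times> {0..?M})" by simp
  also have "\<dots> = (2 ^ l + 1)\<^sup>2"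
    by (simp add: card_cartesian_product nat_add_distrib nat_power_eq power2_eq_square)
  finally show ?thesis .
qed

lemma finite_frame: "finite (frame M H)"
  by (simp add: frame_def)

text \<open>An element of \<open>D\<close> satisfying \<open>P\<close> with maximal
  \<open>\<mu>\<close> could not escape further.\<close>

lemma no_finite_escape:
  fixes \<mu> :: "'a \<Rightarrow> int"
  assumes fin: "finite D" and esc: "\<And>d. d \<in> D \<Longrightarrow> P d \<Longrightarrow> \<exists>e\<in>D. P e \<and> \<mu> d < \<mu> e" and d: "d \<in> D"
  shows "\<not> P d"
proof
  assume "P d"
  let ?E = "{d \<in> D. P d}"
  have ne: "\<mu> ` ?E \<noteq> {}" "finite (\<mu> ` ?E)" using fin d \<open>P d\<close> by auto
  then obtain m where m: "m \<in> ?E" "\<mu> m = Max (\<mu> ` ?E)" using Max_in[OF ne(2,1)] by force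
  then obtain e where "e \<in> ?E" "\<mu> m < \<mu> e" using esc by blast
  then show False using m(2) ne(2) by (auto simp flip: not_le)
qed

text \<open>A finite set \<open>D\<close> avoiding tiles and holes has only cells outside the square
  or the missing corner. From the outside it could move outward forever, and from the corner it
  reaches \<open>(-1, 0)\<close>.\<close>

lemma holes_frame:
  assumes sep: "separated M H" and M: "M \<ge> 1"
  shows "holes (frame M H) = card H"
proof (rule holes_eq_card[OF finite_frame])
  have H: "H \<subseteq> {1..M - 1} \<times> {1..M - 1}" and nadj: "\<And>p q. p \<in> H \<Longrightarrow> q \<in> H \<Longrightarrow> \<not> adj p q"
    using sep unfolding separated_def by auto
  show "H \<inter> frame M H = {}" by (auto simp: frame_def)
  show "q \<in> frame M H" if "s \<in> H" "adj s q" for s q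
  proof -
    have "q \<notin> H" using that nadj by blast
    moreover have "fst s \<in> {1..M-1}" "snd s \<in> {1..M-1}" using that H by auto
    then have "fst q + snd q \<noteq> 0 \<and> fst q \<in> {0..M} \<and> snd q \<in> {0..M}"
      using that(2) unfolding adj_def by auto
    ultimately show ?thesis by (cases q) (auto simp: frame_def)
  qed
  fix D assume D: "finite D" "D \<noteq> {}" "D \<inter> frame M H = {}"
    and cl: "\<And>a b. a \<in> D \<Longrightarrow> adj a b \<Longrightarrow> b \<in> D \<union> frame M H"
  show "D \<inter> H \<noteq> {}"
  proof
    assume DH: "D \<inter> H = {}"
    have out: "fst d < 0 \<or> fst d > M \<or> snd d < 0 \<or> snd d > M \<or> d = (0, 0)" if "d \<in> D" for d
      using that D(3) DH by (cases d) (auto simp: frame_def)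
    have step: "b \<in> D" if "a \<in> D" "adj a b" "fst b < 0 \<or> fst b > M \<or> snd b < 0 \<or> snd b > M" for a b
      using cl[OF that(1,2)] that(3) by (auto simp: frame_def)
    have "\<not> fst d < 0" if "d \<in> D" for d
    proof (rule no_finite_escape[OF D(1) _ that, where \<mu> = "\<lambda>d. - fst d"])
      fix d assume "d \<in> D" "fst d < 0"
      then show "\<exists>e\<in>D. fst e < 0 \<and> - fst d < - fst e"
        using step[of d "(fst d - 1, snd d)"] by (intro bexI[of _ "(fst d - 1, snd d)"]) (auto simp: adj_def)
    qed
    moreover have "\<not> fst d > M" if "d \<in> D" for d
    proof (rule no_finite_escape[OF D(1) _ that, where \<mu> = "\<lambda>d. fst d"])
      fix d assume "d \<in> D" "fst d > M"
      then show "\<exists>e\<in>D. fst e > M \<and> fst d < fst e"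
        using step[of d "(fst d + 1, snd d)"] by (intro bexI[of _ "(fst d + 1, snd d)"]) (auto simp: adj_def)
    qed
    moreover have "\<not> snd d < 0" if "d \<in> D" for d
    proof (rule no_finite_escape[OF D(1) _ that, where \<mu> = "\<lambda>d. - snd d"])
      fix d assume "d \<in> D" "snd d < 0"
      then show "\<exists>e\<in>D. snd e < 0 \<and> - snd d < - snd e"
        using step[of d "(fst d, snd d - 1)"] by (intro bexI[of _ "(fst d, snd d - 1)"]) (auto simp: adj_def)
    qed
    moreover have "\<not> snd d > M" if "d \<in> D" for d
    proof (rule no_finite_escape[OF D(1) _ that, where \<mu> = "\<lambda>d. snd d"])
      fix d assume "d \<in> D" "snd d > M"
      then show "\<exists>e\<in>D. snd e > M \<and> snd d < snd e"
        using step[of d "(fst d, snd d + 1)"] by (intro bexI[of _ "(fst d, snd d + 1)"]) (auto simp: adj_def)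
    qed
    ultimately have "D \<subseteq> {(0, 0)}" using out by blast
    then have "(0, 0) \<in> D" using D(2) by blast
    then have "(-1, 0) \<in> D" using step[of "(0, 0)" "(-1, 0)"] by (auto simp: adj_def)
    then show False using \<open>D \<subseteq> {(0, 0)}\<close> by auto
  qed
qed

text \<open>The bound on \<open>card B\<close> is an inequality so that one argument yields both the
  minimality of the frame and the uniqueness of the minimiser.\<close>

lemma few_tiles_imp_free_equiv:
  assumes l: "l \<ge> 1" and B: "polyomino B" "holes B = card (hole_pattern l)"
    and le: "card B \<le> card (frame (2 ^ l) (hole_pattern l))"
  shows "free_equiv (frame (2 ^ l) (hole_pattern l)) B" "card B = card (frame (2 ^ l) (hole_pattern l))"
proof -
  define h m where "h = card (hole_pattern l)" and "m = (2 ^ l + 1 :: nat)"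
  have m1: "(m - 1)\<^sup>2 = 4 ^ l" by (simp add: m_def power2_eq_square flip: power_mult_distrib)
  have "(2::nat) ^ 1 \<le> 2 ^ l" using l by (intro power_increasing) auto
  then have m3: "m \<ge> 3" by (simp add: m_def)
  have h3: "3 * h + 1 = (m - 1)\<^sup>2" using card_hole_pattern[of l] m1 by (simp add: h_def)
  have "4 ^ 1 \<le> (4::nat) ^ l" using l by (intro power_increasing) auto
  then have h1: "h \<ge> 1" using h3 m1 by simp
  have fin: "finite B" using B(1) by (simp add: polyomino_def)
  have con: "edge_connected B" using polyomino_imp_edge_connected B(1) .
  define I C where "I = {C \<in> components (- region B). bounded C}" and "C = inner_cells"
  have hf: "hole_family B I C"
    unfolding I_def C_def using hole_family_components[OF fin] B(2) h1 h_def by simp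
  have cI: "card I = h" using B(2) by (simp add: I_def holes_def h_def)
  define H F where "H = (\<Union>i\<in>I. C i)" and "F = B \<union> H"
  note bnd = hole_family_filled_bound[OF fin con hf, folded H_def, folded F_def, unfolded cI]
  have finI: "finite I" and HB: "H \<inter> B = {}"
    using hf unfolding hole_family_def H_def by blast+
  have "finite H" unfolding H_def using hf unfolding hole_family_def by blast
  then have finF: "finite F" using fin by (simp add: F_def)
  have FXY: "F \<subseteq> fst ` F \<times> snd ` F" by force
  have "card F \<le> card (fst ` F \<times> snd ` F)" using finF FXY by (intro card_mono) auto
  then have area: "card F \<le> card (fst ` F) * card (snd ` F)" by (simp add: card_cartesian_product)
  have "card B + h + 1 \<le> m\<^sup>2" using le card_frame_hole_pattern[of l] by (simp add: h_def m_def)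
  note num = near_square_numbers[OF m3 h3 bnd(1) order_trans[OF bnd(2) area] this]
  show "card B = card (frame (2 ^ l) (hole_pattern l))"
    using num(1) card_frame_hole_pattern[of l] by (simp add: h_def m_def)
  have tight: "card (adj_pairs B) + 2 = 2 * card B" "per (0, 1) F = card (fst ` F)"
      "per (1, 0) F = card (snd ` F)" "\<And>i. i \<in> I \<Longrightarrow> is_singleton (C i)" "card F = card B + h"
    using bnd(3) num(2) by auto
  have nbr: "q \<in> B" if "p \<in> H" "adj p q" for p q
  proof -
    obtain i where i: "i \<in> I" "p \<in> C i" using \<open>p \<in> H\<close> H_def by blast
    then have "C i = {p}" using tight(4) by (metis is_singleton_def singletonD)
    moreover have "q \<in> C i \<union> B" using hf i that(2) unfolding hole_family_def by blast
    moreover have "p \<noteq> q" using that(2) by (auto simp: adj_def)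
    ultimately show ?thesis by simp
  qed
  \<comment> \<open>Excludes a full rectangle: in a product set the diagonal neighbours of a hole
    are in \<open>F\<close> because its edge neighbours are, so there would be no holes at
    all.\<close>
  have "card (fst ` F) * card (snd ` F) \<noteq> card F"
  proof
    assume "card (fst ` F) * card (snd ` F) = card F"
    then have FXY: "F = fst ` F \<times> snd ` F"
      using finF FXY by (intro card_subset_eq) (auto simp: card_cartesian_product)
    have "H = {}"
    proof (rule area_potential_no_isolated_cells[OF _ \<open>finite H\<close> nbr])
      show "area_potential B"
        using area_potential_image[OF fin con tight(1), of "\<lambda>p. p"] by simp
      fix x y i j :: int assume *: "(x, y) \<in> H" "\<bar>i\<bar> = 1" "\<bar>j\<bar> = 1"
      have "(x + i, y) \<in> F" "(x, y + j) \<in> F"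
        using nbr[OF *(1), of "(x + i, y)"] nbr[OF *(1), of "(x, y + j)"] *(2,3)
        unfolding F_def by (simp_all add: adj_def)
      then have "(x + i, y + j) \<in> F" by (subst FXY) force
      then show "(x + i, y + j) \<in> B \<union> H" by (simp add: F_def)
    qed
    then have "card F = card B" by (simp add: F_def)
    then show False using tight(5) h1 by simp
  qed
  then have "card (fst ` F) = m" "card (snd ` F) = m" using num(3) tight(5) by auto
  then have mm: "card (fst ` F) = Suc (2 ^ l)" "card (snd ` F) = Suc (2 ^ l)" by (simp_all add: m_def)
  have cF: "card F + 1 = (Suc (2 ^ l))\<^sup>2" using num(1) tight(5) by (simp add: m_def)
  have k: "(2::nat) ^ l \<ge> 1" by simp
  obtain a b p q where F: "F = {a..a + int (2 ^ l)} \<times> {b..b + int (2 ^ l)} - {(p, q)}"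
    "p = a \<or> p = a + int (2 ^ l)" "q = b \<or> q = b + int (2 ^ l)"
    by (rule square_minus_corner[OF finF k mm(1) tight(2) mm(2) tight(3) cF])
  let ?M = "2 ^ l :: int"
  \<comment> \<open>The signs make the square extend from the missing corner in the positive
    directions.\<close>
  define s u where "s = (if p = a then 1 else -1 :: int)" and "u = (if q = b then 1 else -1 :: int)"
  have su: "\<bar>s\<bar> = 1" "\<bar>u\<bar> = 1" by (auto simp: s_def u_def)
  let ?f = "flip s u (p, q)"
  note adjf = adj_flip[OF su, of "(p, q)"]
  have fF: "?f ` F = {0..?M} \<times> {0..?M} - {(0, 0)}"
  proof -
    have "?f ` ({a..a + ?M} \<times> {b..b + ?M}) = {0..?M} \<times> {0..?M}"
    proof (intro equalityI subsetI)
      fix z assume "z \<in> ?f ` ({a..a + ?M} \<times> {b..b + ?M})"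
      then show "z \<in> {0..?M} \<times> {0..?M}" using F(2,3) by (auto simp: flip_def s_def u_def)
    next
      fix z assume z: "z \<in> {0..?M} \<times> {0..?M}"
      have "z = ?f (s * fst z + p, u * snd z + q)"
        using flip_onto[OF su, of "(p, q)" z] by simp
      moreover have "(s * fst z + p, u * snd z + q) \<in> {a..a + ?M} \<times> {b..b + ?M}"
        using z F(2,3) by (auto simp: s_def u_def)
      ultimately show "z \<in> ?f ` ({a..a + ?M} \<times> {b..b + ?M})" by blast
    qed
    moreover have "?f (p, q) = (0, 0)" by (simp add: flip_def)
    ultimately show ?thesis unfolding F(1) by (simp add: image_set_diff[OF inj_flip[OF su]])
  qed
  have fB: "?f ` B = frame ?M (?f ` H)"
  proof -
    have "B = F - H" using HB by (auto simp: F_def)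
    then have "?f ` B = ?f ` F - ?f ` H" by (simp add: image_set_diff[OF inj_flip[OF su]])
    then show ?thesis by (simp add: fF frame_def)
  qed
  have "separated ?M (?f ` H)"
    unfolding separated_def
  proof (intro conjI ballI)
    show "?f ` H \<subseteq> {1..?M - 1} \<times> {1..?M - 1}"
    proof
      fix z assume "z \<in> ?f ` H"
      then obtain w where w: "w \<in> H" "z = ?f w" by blast
      \<comment> \<open>All four neighbours of a hole are tiles and so lie in the square; this puts
        the hole itself strictly inside.\<close>
      have nb: "z' \<in> {0..?M} \<times> {0..?M}" if "adj z z'" for z'
      proof -
        obtain w' where w': "z' = ?f w'" using flip_onto[OF su] by metis
        then have "w' \<in> B" using nbr[OF w(1)] that w(2) adjf by blast
        then have "z' \<in> ?f ` F" using w' by (auto simp: F_def)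
        then show ?thesis using fF by blast
      qed
      show "z \<in> {1..?M - 1} \<times> {1..?M - 1}"
        using nb[of "(fst z + 1, snd z)"] nb[of "(fst z - 1, snd z)"] nb[of "(fst z, snd z + 1)"]
          nb[of "(fst z, snd z - 1)"]
        by (cases z) (simp add: adj_def)
    qed
    fix z z' assume "z \<in> ?f ` H" "z' \<in> ?f ` H"
    then show "\<not> adj z z'" using nbr HB adjf by blast
  qed
  moreover have "edge_connected (frame ?M (?f ` H))"
    unfolding fB[symmetric] using edge_connected_image[OF con adjf] .
  moreover have "area_potential (frame ?M (?f ` H))"
    unfolding fB[symmetric] using area_potential_image[OF fin con tight(1) inj_flip[OF su] adjf] .
  ultimately have "?f ` H = hole_pattern l" by (rule hole_pattern_unique)
  then have "?f ` B = frame ?M (hole_pattern l)" using fB by simp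
  then show "free_equiv (frame (2 ^ l) (hole_pattern l)) B"
    using free_equiv_flip[OF su, of "(p, q)" B] by simp
qed

theorem theorem6:
  fixes l :: nat
  assumes "l \<ge> 1"
  shows "\<exists>A. crystallized A \<and> holes A = (2 ^ (2 * l) - 1) div 3 \<and>
           (\<forall>B. crystallized B \<and> holes B = (2 ^ (2 * l) - 1) div 3 \<longrightarrow> free_equiv A B)"
proof -
  let ?A = "frame (2 ^ l) (hole_pattern l)" and ?h = "card (hole_pattern l)"
  have "(2::nat) ^ (2 * l) = 3 * ?h + 1" using card_hole_pattern[of l] by (simp add: power_mult)
  then have h: "(2 ^ (2 * l) - 1) div 3 = ?h" by simp
  have "4 ^ 1 \<le> (4::nat) ^ l" using assms by (intro power_increasing) auto
  then have h1: "?h \<ge> 1" using card_hole_pattern[of l] by simp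
  have poly: "polyomino ?A"
    by (rule edge_connected_imp_polyomino[OF finite_frame edge_connected_hole_pattern])
  have hA: "holes ?A = ?h" by (rule holes_frame[OF separated_hole_pattern]) simp
  have g: "g ?h = card ?A"
    unfolding g_def
  proof (rule Least_equality)
    show "\<exists>A. polyomino A \<and> holes A = ?h \<and> card A = card ?A" using poly hA by blast
    \<comment> \<open>A polyomino with at most \<open>card ?A\<close> tiles and the same number of
      holes has exactly \<open>card ?A\<close> tiles.\<close>
    show "card ?A \<le> n" if "\<exists>A. polyomino A \<and> holes A = ?h \<and> card A = n" for n
      using that few_tiles_imp_free_equiv(2)[OF assms] by (metis nat_le_linear order_refl)
  qed
  show ?thesis
    unfolding h
  proof (intro exI[of _ ?A] conjI allI impI)
    show "crystallized ?A" using poly hA h1 g by (simp add: crystallized_def)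
    show "holes ?A = ?h" by (rule hA)
    show "free_equiv ?A B" if "crystallized B \<and> holes B = ?h" for B
      using that few_tiles_imp_free_equiv(1)[OF assms, of B] g by (auto simp: crystallized_def)
  qed
qed

end
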